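(* Let $G$ be a finite group with chief length $c(G)=c$. Then there are $A,B\in\mathbb{N}$ such that $$An^{c}\le|\mathfrak{C}(G\wr\mathcal{I}_n)|\le Bn^{2c-1}.$$
   Context: $\mathfrak{C}(S)$ denotes the lattice of all congruences on a semigroup $S$. Here $n$ is a positive integer, and $A,B$ are constants determined by $G$ (not depending on $n$). Maps are written on the right and composed left to right. $\mathcal{I}_n$ is the symmetric inverse monoid of all partial bijections of $[n]=\{1,\dots,n\}$. Put $G^0=G\cup\{0\}$ with $0g=g0=0$. For $h\in(G^0)^n$ and $a\in\mathcal{I}_n$ write $h_a=(h_{1a},\dots,h_{na})$, with $h_{ia}=0$ if $ia$ is undefined. Then $$G\wr\mathcal{I}_n=\{(g;a)\in(G^0)^n\times\mathcal{I}_n\mid g_i\neq0\iff i\in\mathrm{Dom}(a)\},\qquad(g;a)(h;b)=(gh_a;ab),$$ an inverse monoid (isomorphic to the partial automorphism monoid of the free $G$-act of rank $n$). A chief series of $G$ is a maximal strictly increasing chain of normal subgroups of $G$, and the chief length $c(G)$ is the maximum length of a chief series.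
   Formalization: A is a positive real constant instead of a natural number: A=0 would make the lower bound empty, and a positive integer A fails, e.g. for G = A5 wr A5 (c=3), where the number of congruences is n^3/2 + O(n^2). Chief length counts the terms of the series. *)

theory Defs
  imports Complex_Main "HOL-Algebra.Coset"
begin

definition semigroup_congruence :: "('a, 'b) monoid_scheme \<Rightarrow> ('a \<times> 'a) set \<Rightarrow> bool" where
  "semigroup_congruence S \<rho> \<longleftrightarrow> equiv (carrier S) \<rho> \<and>
     (\<forall>(x, y) \<in> \<rho>. \<forall>z \<in> carrier S.
        (x \<otimes>\<^bsub>S\<^esub> z, y \<otimes>\<^bsub>S\<^esub> z) \<in> \<rho> \<and> (z \<otimes>\<^bsub>S\<^esub> x, z \<otimes>\<^bsub>S\<^esub> y) \<in> \<rho>)"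

definition congruences :: "('a, 'b) monoid_scheme \<Rightarrow> ('a \<times> 'a) set set" where
  "congruences S = {\<rho>. semigroup_congruence S \<rho>}"

definition chief_series :: "('a, 'b) monoid_scheme \<Rightarrow> 'a set set \<Rightarrow> bool" where
  "chief_series G C \<longleftrightarrow> subset.maxchain {N. N \<lhd> G} C"

text \<open>The length of a chief series is the number of its terms, both the trivial subgroup
  and the whole group being counted. So the trivial group has chief length 1, and a nontrivial
  simple group has chief length 2.\<close>

definition chief_length :: "('a, 'b) monoid_scheme \<Rightarrow> nat" where
  "chief_length G = Max (card ` {C. chief_series G C})"

text \<open>A partial bijection of [n] is a partial map \<open>nat \<rightharpoonup> nat\<close>. Maps act on
  the right, so that the product \<open>a b\<close> applies \<open>a\<close> first, whereas \<open>\<circ>\<^sub>m\<close> is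
  right to left.\<close>

definition sym_inv_monoid :: "nat \<Rightarrow> (nat \<rightharpoonup> nat) monoid" where
  "sym_inv_monoid n =
     \<lparr>carrier = {a. dom a \<subseteq> {1..n} \<and> ran a \<subseteq> {1..n} \<and> inj_on a (dom a)},
      mult = (\<lambda>a b. b \<circ>\<^sub>m a),
      one = (\<lambda>i. if i \<in> {1..n} then Some i else None)\<rparr>"

text \<open>The adjoined zero is \<open>None\<close>.\<close>

definition adjoin_zero :: "('a, 'b) monoid_scheme \<Rightarrow> 'a option monoid" where
  "adjoin_zero G =
     \<lparr>carrier = insert None (Some ` carrier G),
      mult = (\<lambda>x y. case (x, y) of (Some g, Some h) \<Rightarrow> Some (g \<otimes>\<^bsub>G\<^esub> h) | _ \<Rightarrow> None),
      one = Some \<one>\<^bsub>G\<^esub>\<rparr>"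

text \<open>An n-tuple is a function on \<open>nat\<close> that takes the value \<open>None\<close> outside [n], so
  that distinct functions represent distinct tuples.\<close>

definition zero_tuples :: "('a, 'b) monoid_scheme \<Rightarrow> nat \<Rightarrow> (nat \<Rightarrow> 'a option) set" where
  "zero_tuples G n =
     {g. (\<forall>i \<in> {1..n}. g i \<in> carrier (adjoin_zero G)) \<and> (\<forall>i. i \<notin> {1..n} \<longrightarrow> g i = None)}"

definition tuple_act :: "(nat \<Rightarrow> 'a option) \<Rightarrow> (nat \<rightharpoonup> nat) \<Rightarrow> nat \<Rightarrow> 'a option" where
  "tuple_act h a = (\<lambda>i. case a i of Some j \<Rightarrow> h j | None \<Rightarrow> None)"

definition wreath_sym_inv ::
    "('a, 'b) monoid_scheme \<Rightarrow> nat \<Rightarrow> ((nat \<Rightarrow> 'a option) \<times> (nat \<rightharpoonup> nat)) monoid" where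
  "wreath_sym_inv G n =
     \<lparr>carrier = {(g, a). g \<in> zero_tuples G n \<and> a \<in> carrier (sym_inv_monoid n) \<and>
                   (\<forall>i \<in> {1..n}. g i \<noteq> None \<longleftrightarrow> i \<in> dom a)},
      mult = (\<lambda>(g, a) (h, b).
                ((\<lambda>i. g i \<otimes>\<^bsub>adjoin_zero G\<^esub> tuple_act h a i), a \<otimes>\<^bsub>sym_inv_monoid n\<^esub> b)),
      one = ((\<lambda>i. if i \<in> {1..n} then \<one>\<^bsub>adjoin_zero G\<^esub> else None), \<one>\<^bsub>sym_inv_monoid n\<^esub>)\<rparr>"

end

theory Submission
  imports "HOL-Library.Infinite_Set" "HOL-Combinatorics.Permutations" Defs
begin

text \<open>
  Write \<open>S\<close> for \<open>G \<wr> I\<^sub>n\<close> and \<open>W r\<close> for the wreath product of \<open>G\<close> with the symmetric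
  group on \<open>{1..r}\<close>, which is the group of units of the local monoid at an idempotent of rank
  \<open>r\<close>. A congruence on \<open>S\<close> collapses all elements up to some rank \<open>q\<close>, its level, to zero.
  Above that rank it only relates elements with the same domain and the same image, and is therefore
  given by normal subgroups \<open>N r\<close> of \<open>W r\<close> for \<open>q < r \<le> n\<close> (\<open>related_same_domain_image\<close>,
  \<open>related_iff_unit\<close>, \<open>subset_of_units_class\<close>).

  The normal subgroups are coupled by restriction from \<open>r\<close> to \<open>r - 1\<close> points. For
  \<open>r \<ge> q + 2\<close> this forces \<open>N r\<close> into the base group of tuples. Let \<open>K r\<close> be the set of first
  entries of base tuples in \<open>N r\<close>, and \<open>M r\<close> the set of \<open>g\<close> for which the tuple with first
  entry \<open>g\<close> and trivial other entries is in \<open>N r\<close>. Both are normal in \<open>G\<close> and shrink as \<open>r\<close>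
  grows. For a base tuple in \<open>N r\<close>, the quotient of two entries, placed at one position with its
  inverse at another, is again in \<open>N r\<close>; restriction discards the inverse, so the quotient is in
  \<open>M (r - 1)\<close>. Hence, if \<open>M r = M (r - 1)\<close>, then \<open>N r\<close> consists of all tuples over
  \<open>K r\<close> whose entries agree modulo \<open>M r\<close> (\<open>units_class_determined\<close>). A congruence is thus
  determined by \<open>N r\<close> at the rank \<open>q + 1\<close> and at the ranks where \<open>K\<close> or \<open>M\<close> changes
  (\<open>subset_of_jump_data\<close>). The chief length \<open>c\<close> counts the terms of a chief series, so each of
  \<open>K\<close> and \<open>M\<close> changes at most \<open>c - 1\<close> times, which makes at most \<open>2 c - 1\<close> ranks in all. Up to a
  constant, there are \<open>n\<close> to the power \<open>2 c - 1\<close> ways to choose these ranks.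

  For the upper bound it remains to see that \<open>W r\<close> has a number of normal subgroups that is bounded
  independently of \<open>r\<close> (\<open>card_wreath_normals_bounded\<close>). For \<open>r \<ge> 5\<close> a normal subgroup either
  lies in the base group or contains all three-cycles, by a commutator argument. In both cases each
  of its elements can be reduced, within the subgroup, to one of a bounded number of normal forms, so
  that the subgroup is determined by which of these it contains.

  For the lower bound, fix a chief series with \<open>c\<close> terms. Let the ranks up to some rank be
  collapsed, and above it relate elements with the same partial bijection whose entries agree modulo
  a term of the series that becomes smaller as the rank grows. The \<open>c\<close> ranks at which the
  layers end can be any \<open>c\<close>-element subset of \<open>{1..n}\<close>, and different subsets give
  different congruences (\<open>binomial_le_card_congruences\<close>). There are at least
  \<open>(n / c)\<^sup>c\<close> such subsets if \<open>c \<le> n\<close>.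
\<close>

section \<open>Normal subgroups of the wreath product of a group with a symmetric group\<close>

text \<open>Permutations act on the right, so the product of \<open>(f, p)\<close> and \<open>(h, s)\<close> applies
  \<open>p\<close> first. Tuples are trivial outside \<open>{1..r}\<close>, so that distinct functions represent
  distinct tuples.\<close>

definition wreath_sym :: "('a, 'b) monoid_scheme \<Rightarrow> nat \<Rightarrow> ((nat \<Rightarrow> 'a) \<times> (nat \<Rightarrow> nat)) monoid" where
  "wreath_sym G r =
     \<lparr>carrier = {(f, p). (\<forall>i. f i \<in> carrier G) \<and> (\<forall>i. i \<notin> {1..r} \<longrightarrow> f i = \<one>\<^bsub>G\<^esub>) \<and> p permutes {1..r}},
      mult = (\<lambda>(f, p) (h, s). (\<lambda>i. f i \<otimes>\<^bsub>G\<^esub> h (p i), s \<circ> p)),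
      one = (\<lambda>_. \<one>\<^bsub>G\<^esub>, id)\<rparr>"

definition single :: "('a, 'b) monoid_scheme \<Rightarrow> nat \<Rightarrow> 'a \<Rightarrow> nat \<Rightarrow> 'a" where
  "single G i g = (\<lambda>_. \<one>\<^bsub>G\<^esub>)(i := g)"

definition antipodal :: "('a, 'b) monoid_scheme \<Rightarrow> nat \<Rightarrow> nat \<Rightarrow> 'a \<Rightarrow> nat \<Rightarrow> 'a" where
  "antipodal G i j g = (\<lambda>_. \<one>\<^bsub>G\<^esub>)(i := g, j := inv\<^bsub>G\<^esub> g)"

definition almost_constant :: "('a, 'b) monoid_scheme \<Rightarrow> nat \<Rightarrow> 'a \<Rightarrow> 'a \<Rightarrow> nat \<Rightarrow> 'a" where
  "almost_constant G r u v = (\<lambda>i. if i = 1 then u else if i \<in> {1..r} then v else \<one>\<^bsub>G\<^esub>)"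

lemma wreath_sym_mult [simp]:
  "(f, p) \<otimes>\<^bsub>wreath_sym G r\<^esub> (h, s) = (\<lambda>i. f i \<otimes>\<^bsub>G\<^esub> h (p i), s \<circ> p)"
  by (simp add: wreath_sym_def)

lemma wreath_sym_one: "\<one>\<^bsub>wreath_sym G r\<^esub> = (\<lambda>_. \<one>\<^bsub>G\<^esub>, id)"
  by (simp add: wreath_sym_def)

lemma wreath_sym_carrier_iff:
  "(f, p) \<in> carrier (wreath_sym G r) \<longleftrightarrow>
     (\<forall>i. f i \<in> carrier G) \<and> (\<forall>i. i \<notin> {1..r} \<longrightarrow> f i = \<one>\<^bsub>G\<^esub>) \<and> p permutes {1..r}"
  by (simp add: wreath_sym_def)

lemma permutes_extending_inj:
  assumes "finite S" "A \<subseteq> S" "inj_on f A" "f ` A \<subseteq> S"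
  shows "\<exists>p. p permutes S \<and> (\<forall>a\<in>A. p a = f a)"
proof -
  have "card (S - A) = card (S - f ` A)"
    using assms by (simp add: card_Diff_subset finite_subset card_image)
  then obtain g where g: "bij_betw g (S - A) (S - f ` A)"
    using assms(1) by (metis finite_Diff finite_same_card_bij)
  define p where "p = (\<lambda>x. if x \<in> A then f x else if x \<in> S then g x else x)"
  have "bij_betw p A (f ` A)"
    using assms(3) by (auto simp: p_def bij_betw_def inj_on_def)
  moreover have "bij_betw p (S - A) (S - f ` A)"
    using g by (subst bij_betw_cong[where g = g]) (auto simp: p_def)
  ultimately have "bij_betw p (A \<union> (S - A)) (f ` A \<union> (S - f ` A))"
    by (rule bij_betw_combine) auto
  moreover have "A \<union> (S - A) = S" "f ` A \<union> (S - f ` A) = S"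
    using assms by auto
  ultimately have "p permutes S"
    using assms(2) by (auto intro!: bij_imp_permutes simp: p_def)
  then show ?thesis
    by (intro exI[of _ p]) (simp add: p_def)
qed

context group
begin

abbreviation "W \<equiv> wreath_sym G"

lemma wreath_sym_group: "group (W r)"
proof (rule groupI)
  show "\<one>\<^bsub>W r\<^esub> \<in> carrier (W r)"
    by (simp add: wreath_sym_one wreath_sym_carrier_iff permutes_id)
next
  fix x y assume "x \<in> carrier (W r)" "y \<in> carrier (W r)"
  then show "x \<otimes>\<^bsub>W r\<^esub> y \<in> carrier (W r)"
    by (cases x; cases y) (auto simp: wreath_sym_carrier_iff permutes_compose permutes_not_in)
next
  fix x y z assume "x \<in> carrier (W r)" "y \<in> carrier (W r)" "z \<in> carrier (W r)"
  then show "x \<otimes>\<^bsub>W r\<^esub> y \<otimes>\<^bsub>W r\<^esub> z = x \<otimes>\<^bsub>W r\<^esub> (y \<otimes>\<^bsub>W r\<^esub> z)"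
    by (cases x; cases y; cases z) (auto simp: wreath_sym_carrier_iff m_assoc o_assoc)
next
  fix x assume "x \<in> carrier (W r)"
  then show "\<one>\<^bsub>W r\<^esub> \<otimes>\<^bsub>W r\<^esub> x = x"
    by (cases x) (auto simp: wreath_sym_carrier_iff wreath_sym_one)
next
  fix x assume x: "x \<in> carrier (W r)"
  obtain f p where fp: "x = (f, p)" by force
  have p: "p permutes {1..r}" and f: "\<And>i. f i \<in> carrier G" "\<And>i. i \<notin> {1..r} \<Longrightarrow> f i = \<one>"
    using x by (auto simp: fp wreath_sym_carrier_iff)
  let ?y = "(\<lambda>i. inv f (Hilbert_Choice.inv p i), Hilbert_Choice.inv p)"
  have "?y \<in> carrier (W r)"
    using p f by (auto simp: wreath_sym_carrier_iff permutes_inv permutes_not_in[OF permutes_inv[OF p]])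
  moreover have "?y \<otimes>\<^bsub>W r\<^esub> x = \<one>\<^bsub>W r\<^esub>"
    using p f by (simp add: fp wreath_sym_one permutes_inv_o)
  ultimately show "\<exists>y\<in>carrier (W r). y \<otimes>\<^bsub>W r\<^esub> x = \<one>\<^bsub>W r\<^esub>" by blast
qed

lemma wreath_sym_inv_elt:
  assumes "(f, p) \<in> carrier (W r)"
  shows "inv\<^bsub>W r\<^esub> (f, p) = (\<lambda>i. inv f (Hilbert_Choice.inv p i), Hilbert_Choice.inv p)"
proof -
  interpret W: group "W r" by (rule wreath_sym_group)
  have p: "p permutes {1..r}" and f: "\<And>i. f i \<in> carrier G" "\<And>i. i \<notin> {1..r} \<Longrightarrow> f i = \<one>"
    using assms by (auto simp: wreath_sym_carrier_iff)
  show ?thesis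
  proof (rule W.inv_equality)
    show "(\<lambda>i. inv f (Hilbert_Choice.inv p i), Hilbert_Choice.inv p) \<in> carrier (W r)"
      using p f by (auto simp: wreath_sym_carrier_iff permutes_inv permutes_not_in[OF permutes_inv[OF p]])
    show "(\<lambda>i. inv f (Hilbert_Choice.inv p i), Hilbert_Choice.inv p) \<otimes>\<^bsub>W r\<^esub> (f, p) = \<one>\<^bsub>W r\<^esub>"
      using p f by (simp add: wreath_sym_one permutes_inv_o)
  qed (rule assms)
qed

lemma base_carrier_iff:
  "(f, id) \<in> carrier (W r) \<longleftrightarrow> (\<forall>i. f i \<in> carrier G) \<and> (\<forall>i. i \<notin> {1..r} \<longrightarrow> f i = \<one>)"
  by (simp add: wreath_sym_carrier_iff permutes_id)

lemma perm_carrier_iff: "(\<lambda>_. \<one>, p) \<in> carrier (W r) \<longleftrightarrow> p permutes {1..r}"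
  by (simp add: wreath_sym_carrier_iff)

lemma single_carrier:
  "i \<in> {1..r} \<Longrightarrow> g \<in> carrier G \<Longrightarrow> p permutes {1..r} \<Longrightarrow> (single G i g, p) \<in> carrier (W r)"
  by (auto simp: wreath_sym_carrier_iff single_def)

lemma antipodal_carrier:
  "i \<in> {1..r} \<Longrightarrow> j \<in> {1..r} \<Longrightarrow> g \<in> carrier G \<Longrightarrow> (antipodal G i j g, id) \<in> carrier (W r)"
  by (auto simp: base_carrier_iff antipodal_def)

end

locale wreath_normal = group G for G (structure) +
  fixes r :: nat and N :: "((nat \<Rightarrow> 'a) \<times> (nat \<Rightarrow> nat)) set"
  assumes normal: "N \<lhd> wreath_sym G r"
begin

sublocale W: group "W r" by (rule wreath_sym_group)
sublocale N: normal N "W r" by (rule normal)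

lemma in_carrier: "x \<in> N \<Longrightarrow> x \<in> carrier (W r)"
  using N.subset by blast

lemma conj_perm:
  assumes "(f, p) \<in> N" "s permutes {1..r}"
  shows "(f \<circ> s, Hilbert_Choice.inv s \<circ> p \<circ> s) \<in> N"
proof -
  have c: "(\<lambda>_. \<one>, s) \<in> carrier (W r)" using assms(2) by (simp add: perm_carrier_iff)
  have "(\<lambda>_. \<one>, s) \<otimes>\<^bsub>W r\<^esub> (f, p) \<otimes>\<^bsub>W r\<^esub> inv\<^bsub>W r\<^esub> (\<lambda>_. \<one>, s) \<in> N"
    using N.inv_op_closed2[OF c assms(1)] .
  moreover have "\<And>i. f i \<in> carrier G"
    using in_carrier[OF assms(1)] by (simp add: wreath_sym_carrier_iff)
  ultimately show ?thesis
    by (simp add: wreath_sym_inv_elt[OF c] o_def)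
qed

text \<open>A tuple divided by its image under the transposition of two positions is trivial elsewhere.
  This is the source of all antipodal elements.\<close>

lemma base_coord_quotient:
  assumes "(f, id) \<in> N" "i \<in> {1..r}" "j \<in> {1..r}" "i \<noteq> j"
  shows "(antipodal G i j (f i \<otimes> inv f j), id) \<in> N"
proof -
  let ?t = "transpose i j"
  have f: "\<And>i. f i \<in> carrier G" "\<And>i. i \<notin> {1..r} \<Longrightarrow> f i = \<one>"
    using in_carrier[OF assms(1)] by (auto simp: wreath_sym_carrier_iff)
  have t: "?t permutes {1..r}" using assms by (simp add: permutes_swap_id)
  have ft: "(f \<circ> ?t, id) \<in> N"
    using conj_perm[OF assms(1) t] by (simp add: inv_swap_id)
  then have "(f, id) \<otimes>\<^bsub>W r\<^esub> inv\<^bsub>W r\<^esub> (f \<circ> ?t, id) \<in> N"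
    using assms(1) by blast
  moreover have "(f, id) \<otimes>\<^bsub>W r\<^esub> inv\<^bsub>W r\<^esub> (f \<circ> ?t, id) = (antipodal G i j (f i \<otimes> inv f j), id)"
    using f by (auto simp: wreath_sym_inv_elt[OF in_carrier[OF ft]] antipodal_def fun_eq_iff
        inv_mult_group transpose_def)
  ultimately show ?thesis by simp
qed

lemma antipodal_move:
  assumes "(antipodal G i j g, id) \<in> N" "i \<in> {1..r}" "j \<in> {1..r}" "i \<noteq> j"
    and "k \<in> {1..r}" "l \<in> {1..r}" "k \<noteq> l"
  shows "(antipodal G k l g, id) \<in> N"
proof -
  obtain s where s: "s permutes {1..r}" "s k = i" "s l = j"
    using permutes_extending_inj[of "{1..r}" "{k, l}" "\<lambda>x. if x = k then i else j"] assms
    by (auto simp: inj_on_def)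
  have "antipodal G i j g \<circ> s = antipodal G k l g"
    using s(2,3) permutes_inj[OF s(1)] by (auto simp: antipodal_def fun_eq_iff dest: injD)
  then show ?thesis
    using conj_perm[OF assms(1) s(1)] permutes_inv_o[OF s(1)] by simp
qed

lemma three_cycle_move:
  assumes "(\<lambda>_. \<one>, transpose a b \<circ> transpose a c) \<in> N" "distinct [a, b, c]" "{a, b, c} \<subseteq> {1..r}"
    and "distinct [x, y, z]" "{x, y, z} \<subseteq> {1..r}"
  shows "(\<lambda>_. \<one>, transpose x y \<circ> transpose x z) \<in> N"
proof -
  let ?h = "\<lambda>u. if u = x then a else if u = y then b else c"
  have "\<exists>s. s permutes {1..r} \<and> (\<forall>u\<in>{x, y, z}. s u = ?h u)"
    using assms(2-5) by (intro permutes_extending_inj) (auto simp: inj_on_def)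
  then obtain s where s: "s permutes {1..r}" "s x = a" "s y = b" "s z = c"
    using assms(4) by (metis distinct_length_2_or_more insertCI)
  have *: "Hilbert_Choice.inv s \<circ> transpose (s u) (s v) \<circ> s = transpose u v" for u v
    using permutes_bij[OF s(1)]
    by (simp add: fun_eq_iff transpose_apply_commute permutes_inverses[OF s(1)])
  have "Hilbert_Choice.inv s \<circ> (transpose a b \<circ> transpose a c) \<circ> s =
      (Hilbert_Choice.inv s \<circ> transpose a b \<circ> s) \<circ> (Hilbert_Choice.inv s \<circ> transpose a c \<circ> s)"
    by (simp add: fun_eq_iff permutes_inverses[OF s(1)])
  also have "\<dots> = transpose x y \<circ> transpose x z"
    using *[of x y] *[of x z] s by simp
  finally show ?thesis
    using conj_perm[OF assms(1) s(1)] by (simp add: o_def)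
qed

text \<open>The commutator with a one-entry tuple is a two-entry tuple, and one of its two entries
  is arbitrary. Dividing it by its image under a transposition that moves the other entry to a third
  position yields the antipodal element.\<close>

lemma antipodal_of_nontrivial_perm:
  assumes "(f, p) \<in> N" "p \<noteq> id" "r \<ge> 3" "g \<in> carrier G"
    and "k \<in> {1..r}" "l \<in> {1..r}" "k \<noteq> l"
  shows "(antipodal G k l g, id) \<in> N"
proof -
  have x: "(f, p) \<in> carrier (W r)" by (rule in_carrier[OF assms(1)])
  then have p: "p permutes {1..r}" and f: "\<And>i. f i \<in> carrier G" "\<And>i. i \<notin> {1..r} \<Longrightarrow> f i = \<one>"
    by (auto simp: wreath_sym_carrier_iff)
  obtain i where i: "p i \<noteq> i" using assms(2) by fastforce
  have ir: "i \<in> {1..r}" "p i \<in> {1..r}"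
    using i permutes_not_in[OF p, of i] permutes_in_image[OF p, of i] by auto
  have "\<not> {1..r} \<subseteq> {i, p i}"
  proof
    assume "{1..r} \<subseteq> {i, p i}"
    then have "card {1..r} \<le> card {i, p i}" by (intro card_mono) auto
    then show False using assms(3) i by simp
  qed
  then obtain m where m: "m \<in> {1..r}" "m \<noteq> i" "m \<noteq> p i" by blast
  have cancel: "f j \<otimes> (inv f j \<otimes> g) = g" for j
    using f assms(4) by (simp add: m_assoc[symmetric])
  let ?h = "inv g"
  let ?t = "(single G (p i) ?h, id)"
  have t: "?t \<in> carrier (W r)" using ir assms(4) by (intro single_carrier permutes_id) auto
  have "(f, p) \<otimes>\<^bsub>W r\<^esub> (?t \<otimes>\<^bsub>W r\<^esub> inv\<^bsub>W r\<^esub> (f, p) \<otimes>\<^bsub>W r\<^esub> inv\<^bsub>W r\<^esub> ?t) \<in> N"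
    using N.m_closed[OF assms(1) N.inv_op_closed2[OF t N.m_inv_closed[OF assms(1)]]] .
  moreover have "(f, p) \<otimes>\<^bsub>W r\<^esub> (?t \<otimes>\<^bsub>W r\<^esub> inv\<^bsub>W r\<^esub> (f, p) \<otimes>\<^bsub>W r\<^esub> inv\<^bsub>W r\<^esub> ?t) =
      ((\<lambda>_. \<one>)(i := f i \<otimes> ?h \<otimes> inv f i, p i := g), id)"
    unfolding wreath_sym_inv_elt[OF t] wreath_sym_inv_elt[OF x]
    using f i assms(4) permutes_inj[OF p]
    by (auto simp: fun_eq_iff single_def permutes_inverses[OF p] m_assoc cancel dest: injD)
  ultimately have "((\<lambda>_. \<one>)(i := f i \<otimes> ?h \<otimes> inv f i, p i := g), id) \<in> N" by simp
  from base_coord_quotient[OF this ir(2) m(1)] have "(antipodal G (p i) m g, id) \<in> N"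
    using m assms(4) by auto
  then show ?thesis
    using antipodal_move[of "p i" m g k l] ir m assms by auto
qed

text \<open>Multiplying by an antipodal element on the positions \<open>i\<close> and \<open>j\<close> gives the
  \<open>j\<close>-th entry any value that \<open>N\<close> permits and pushes the discrepancy into the \<open>i\<close>-th
  entry. So modulo \<open>N\<close> the entries can be equalized one after another, with position \<open>i\<close>
  as the dump.\<close>

lemma equalize_coordinates:
  assumes anti: "\<And>j. j \<in> F \<Longrightarrow> (antipodal G i j (v \<otimes> inv f j), id) \<in> N"
    and F: "finite F" "F \<subseteq> {1..r} - {i}" and i: "i \<in> {1..r}" and v: "v \<in> carrier G"
    and x: "(f, p) \<in> carrier (W r)"
  shows "\<exists>z\<in>N. \<exists>h. (\<forall>j\<in>F. h j = v) \<and> (\<forall>j. j \<notin> insert i F \<longrightarrow> h j = f j) \<and>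
           (h, p) \<in> carrier (W r) \<and> (f, p) = z \<otimes>\<^bsub>W r\<^esub> (h, p)"
  using F(1,2) anti
proof (induction F rule: finite_induct)
  case empty
  show ?case
    using x by (intro bexI[OF _ N.one_closed] exI[of _ f]) (auto simp: W.l_one)
next
  case (insert k F)
  then obtain z h where z: "z \<in> N" and h: "\<forall>j\<in>F. h j = v" "\<forall>j. j \<notin> insert i F \<longrightarrow> h j = f j"
    "(h, p) \<in> carrier (W r)" "(f, p) = z \<otimes>\<^bsub>W r\<^esub> (h, p)" by auto
  have hc: "\<And>j. h j \<in> carrier G" and hp: "p permutes {1..r}" "\<And>i. i \<notin> {1..r} \<Longrightarrow> h i = \<one>"
    using h(3) by (auto simp: wreath_sym_carrier_iff)
  have k: "k \<in> {1..r}" "k \<noteq> i" using insert.prems by auto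
  define u where "u = v \<otimes> inv h k"
  have hk: "h k = f k" using h(2) insert.hyps k by auto
  let ?d = "(antipodal G i k u, id)"
  have d: "?d \<in> N" unfolding u_def hk by (rule insert.prems(2)) simp
  define h' where "h' = h(i := inv u \<otimes> h i, k := v)"
  have uc: "u \<in> carrier G" and uv: "inv u \<otimes> v = h k"
    using v hc by (auto simp: u_def inv_mult_group m_assoc)
  have "?d \<otimes>\<^bsub>W r\<^esub> (h', p) = (h, p)"
    using hc k uc uv by (auto simp: h'_def antipodal_def fun_eq_iff m_assoc[symmetric])
  moreover have h': "(h', p) \<in> carrier (W r)"
    using hc hp k i v uc by (auto simp: h'_def wreath_sym_carrier_iff)
  ultimately have "(f, p) = (z \<otimes>\<^bsub>W r\<^esub> ?d) \<otimes>\<^bsub>W r\<^esub> (h', p)"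
    using h(4) W.m_assoc[OF in_carrier[OF z] in_carrier[OF d] h'] by (simp only:)
  moreover have "i \<notin> F" using insert.prems by auto
  then have "\<forall>j\<in>insert k F. h' j = v" "\<forall>j. j \<notin> insert i (insert k F) \<longrightarrow> h' j = f j"
    using h(1,2) k by (auto simp: h'_def)
  ultimately show ?case
    using h' N.m_closed[OF z d] by blast
qed

lemma coset_of_single:
  assumes anti: "\<And>j g. j \<in> {1..r} - {i} \<Longrightarrow> g \<in> carrier G \<Longrightarrow> (antipodal G i j g, id) \<in> N"
    and i: "i \<in> {1..r}" and x: "(f, p) \<in> carrier (W r)"
  shows "\<exists>z\<in>N. \<exists>u\<in>carrier G. (f, p) = z \<otimes>\<^bsub>W r\<^esub> (single G i u, p)"
proof -
  have "f j \<in> carrier G" for j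
    using x by (simp add: wreath_sym_carrier_iff)
  then obtain z h where zh: "z \<in> N" "\<forall>j\<in>{1..r} - {i}. h j = \<one>"
     "(h, p) \<in> carrier (W r)" "(f, p) = z \<otimes>\<^bsub>W r\<^esub> (h, p)"
    using equalize_coordinates[of "{1..r} - {i}" i \<one> f p] anti i x by auto
  then have hi: "h i \<in> carrier G"
    by (auto simp: wreath_sym_carrier_iff)
  have "h j = single G i (h i) j" for j
    using zh(2,3) by (cases "j \<in> {1..r}") (auto simp: single_def wreath_sym_carrier_iff)
  then have "h = single G i (h i)" by blast
  then show ?thesis using zh hi by metis
qed

lemma coset_of_almost_constant:
  assumes anti: "\<And>j. j \<in> {3..r} \<Longrightarrow> (antipodal G 1 j (f 2 \<otimes> inv f j), id) \<in> N"
    and r: "r \<ge> 2" and x: "(f, id) \<in> carrier (W r)"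
  shows "\<exists>z\<in>N. \<exists>u\<in>carrier G. \<exists>v\<in>carrier G. (f, id) = z \<otimes>\<^bsub>W r\<^esub> (almost_constant G r u v, id)"
proof -
  have f: "f j \<in> carrier G" for j
    using x by (simp add: wreath_sym_carrier_iff)
  have "finite {3..r}" "{3..r} \<subseteq> {1..r} - {1}" "1 \<in> {1..r}" using r by auto
  from equalize_coordinates[OF anti this f x]
  obtain z h where zh: "z \<in> N" "\<forall>j\<in>{3..r}. h j = f 2" "\<forall>j. j \<notin> insert 1 {3..r} \<longrightarrow> h j = f j"
     "(h, id) \<in> carrier (W r)" "(f, id) = z \<otimes>\<^bsub>W r\<^esub> (h, id)" by blast
  have "h j = almost_constant G r (h 1) (f 2) j" for j
  proof -
    consider "j = 1" | "j = 2" | "j \<in> {3..r}" | "j \<notin> {1..r}" by force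
    then show ?thesis
      using zh(2-4) r by cases (auto simp: almost_constant_def wreath_sym_carrier_iff)
  qed
  then have "h = almost_constant G r (h 1) (f 2)" by blast
  moreover have "h 1 \<in> carrier G" using zh(4) by (simp add: wreath_sym_carrier_iff)
  ultimately show ?thesis using zh f by metis
qed

text \<open>Modulo the antipodal elements, the tuple of an element can be gathered at any chosen position. If a transposition
  and its conjugate by \<open>p\<close> both fix that position, then the entry cancels in the commutator of the element with that transposition, which
  leaves a pure permutation: a product of two transpositions. At most four points are moved by
  the two transpositions, which is why five positions are needed.\<close>

lemma three_cycle_of_nontrivial_perm:
  assumes "(f, p) \<in> N" "p \<noteq> id" "r \<ge> 5"
  shows "(\<lambda>_. \<one>, transpose 1 2 \<circ> transpose 1 3) \<in> N"
proof -
  have pick: "\<exists>m\<in>{1..r}. m \<notin> X" if "finite X" "card X \<le> 4" for X :: "nat set"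
  proof (rule ccontr)
    assume "\<not> ?thesis"
    then have "{1..r} \<subseteq> X" by blast
    then have "card {1..r} \<le> card X" using that by (intro card_mono) auto
    then show False using that assms(3) by simp
  qed
  have x: "(f, p) \<in> carrier (W r)" by (rule in_carrier[OF assms(1)])
  then have p: "p permutes {1..r}" and f: "\<And>i. f i \<in> carrier G" "\<And>i. i \<notin> {1..r} \<Longrightarrow> f i = \<one>"
    by (auto simp: wreath_sym_carrier_iff)
  obtain a' where a': "p a' \<noteq> a'" using assms(2) by fastforce
  define a where "a = p a'"
  have ar: "a \<in> {1..r}" "a' \<in> {1..r}" "a \<noteq> a'"
    using a' permutes_not_in[OF p, of a'] permutes_in_image[OF p, of a'] by (auto simp: a_def)
  obtain b where b: "b \<in> {1..r}" "b \<noteq> a" "b \<noteq> a'"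
    using pick[of "{a, a'}"] ar(3) by auto
  define b' where "b' = Hilbert_Choice.inv p b"
  have pb': "p b' = b" using p by (simp add: b'_def permutes_inverses)
  have b'r: "b' \<in> {1..r}" using b pb' permutes_in_image[OF p, of b'] by simp
  have b'a': "b' \<noteq> a'" using pb' b a_def by auto
  \<comment> \<open>The position of the surviving entry, fixed by both transpositions.\<close>
  obtain e where e: "e \<in> {1..r}" "e \<notin> {a, a', b, b'}"
    using pick[of "{a, a', b, b'}"] card_length[of "[a, a', b, b']"] by auto
  obtain z u where z: "z \<in> N" and u: "u \<in> carrier G" and zu: "(f, p) = z \<otimes>\<^bsub>W r\<^esub> (single G e u, p)"
    using coset_of_single[OF antipodal_of_nontrivial_perm[OF assms(1,2)], of e f p] e(1) assms(3) x
    by auto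
  have y: "(single G e u, p) \<in> carrier (W r)" using e u p by (intro single_carrier)
  have yN: "(single G e u, p) \<in> N"
  proof -
    have "(single G e u, p) = inv\<^bsub>W r\<^esub> z \<otimes>\<^bsub>W r\<^esub> (f, p)"
      using zu W.inv_solve_left[OF y in_carrier[OF z] x] by blast
    then show ?thesis using z assms(1) by auto
  qed
  let ?t = "(\<lambda>_. \<one>, transpose a b)"
  have tp: "transpose a b permutes {1..r}" using ar b by (simp add: permutes_swap_id)
  have t: "?t \<in> carrier (W r)" using tp by (simp add: perm_carrier_iff)
  have "(single G e u, p) \<otimes>\<^bsub>W r\<^esub> (?t \<otimes>\<^bsub>W r\<^esub> inv\<^bsub>W r\<^esub> (single G e u, p) \<otimes>\<^bsub>W r\<^esub> inv\<^bsub>W r\<^esub> ?t) \<in> N"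
    using N.m_closed[OF yN N.inv_op_closed2[OF t N.m_inv_closed[OF yN]]] .
  moreover have conj: "Hilbert_Choice.inv p \<circ> transpose a b \<circ> p = transpose a' b'"
    using permutes_bij[OF p] pb'[symmetric]
    by (simp add: fun_eq_iff transpose_apply_commute permutes_inverses[OF p] a_def)
  have conj': "Hilbert_Choice.inv p (transpose a b (p i)) = transpose a' b' i" for i
    using conj by (metis comp_apply)
  have fixes_e: "single G e u (transpose a' b' i) = single G e u i" for i
    using e by (auto simp: single_def transpose_def)
  have uc: "single G e u i \<in> carrier G" for i
    using u by (simp add: single_def)
  have "(single G e u, p) \<otimes>\<^bsub>W r\<^esub> (?t \<otimes>\<^bsub>W r\<^esub> inv\<^bsub>W r\<^esub> (single G e u, p) \<otimes>\<^bsub>W r\<^esub> inv\<^bsub>W r\<^esub> ?t) =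
      (\<lambda>_. \<one>, transpose a b \<circ> transpose a' b')"
    unfolding wreath_sym_inv_elt[OF t] wreath_sym_inv_elt[OF y]
    by (simp add: fun_eq_iff conj' fixes_e uc inv_swap_id)
  ultimately have w: "(\<lambda>_. \<one>, transpose a b \<circ> transpose a' b') \<in> N" by simp
  have "\<exists>x y z. distinct [x, y, z] \<and> {x, y, z} \<subseteq> {1..r} \<and> (\<lambda>_. \<one>, transpose x y \<circ> transpose x z) \<in> N"
  proof -
    \<comment> \<open>In the first two cases the transpositions share exactly one point. Otherwise they are disjoint, and a product with a conjugate by a transposition involving the fifth point gives a three-cycle.\<close>
    consider "b' = b" | "b' = a" | "b' \<noteq> b" "b' \<noteq> a" by blast
    then show ?thesis
    proof cases
      case 1
      then show ?thesis using w ar b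
        by (intro exI[of _ b] exI[of _ a] exI[of _ a']) (auto simp: transpose_commute)
    next
      case 2
      then show ?thesis using w ar b
        by (intro exI[of _ a] exI[of _ b] exI[of _ a']) (auto simp: transpose_commute)
    next
      case 3
      have s: "transpose b e permutes {1..r}" using b e by (simp add: permutes_swap_id)
      have "transpose b e \<circ> (transpose a b \<circ> transpose a' b') \<circ> transpose b e = transpose a e \<circ> transpose a' b'"
        using 3 ar b b'a' e by (auto simp: fun_eq_iff transpose_def)
      then have v: "(\<lambda>_. \<one>, transpose a e \<circ> transpose a' b') \<in> N"
        using conj_perm[OF w s] by (simp add: o_def inv_swap_id)
      have "(transpose a b \<circ> transpose a' b') \<circ> (transpose a e \<circ> transpose a' b') = transpose a b \<circ> transpose a e"
        using 3 ar b b'a' e by (auto simp: fun_eq_iff transpose_def)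
      then have "(\<lambda>_. \<one>, transpose a b \<circ> transpose a e) \<in> N"
        using N.m_closed[OF v w] by simp
      then show ?thesis using ar b e
        by (intro exI[of _ a] exI[of _ b] exI[of _ e]) auto
    qed
  qed
  then obtain x y z where "distinct [x, y, z]" "{x, y, z} \<subseteq> {1..r}" "(\<lambda>_. \<one>, transpose x y \<circ> transpose x z) \<in> N"
    by blast
  then show ?thesis using three_cycle_move[of x y z 1 2 3] assms(3) by auto
qed

text \<open>Three-cycles straighten the permutation, fixing the points from the top downwards until only
  1 and 2 can move; the antipodal elements, which come for free with the three-cycles,
  then gather the tuple in its first entry.\<close>

lemma coset_of_transposition:
  assumes c: "(\<lambda>_. \<one>, transpose 1 2 \<circ> transpose 1 3) \<in> N" and r: "r \<ge> 3"
    and x: "(f, p) \<in> carrier (W r)"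
  shows "\<exists>z\<in>N. \<exists>u\<in>carrier G. \<exists>t\<in>{id, transpose 1 2}. (f, p) = z \<otimes>\<^bsub>W r\<^esub> (single G 1 u, t)"
proof -
  have ne: "transpose 1 2 \<circ> transpose 1 3 \<noteq> (id :: nat \<Rightarrow> nat)"
  proof
    assume "transpose 1 2 \<circ> transpose 1 3 = (id :: nat \<Rightarrow> nat)"
    then have "(transpose 1 2 \<circ> transpose 1 3) (1::nat) = 1" by simp
    then show False by (simp add: transpose_def)
  qed
  have "\<exists>z\<in>N. \<exists>h. \<exists>t\<in>{id, transpose 1 2}. (h, t) \<in> carrier (W r) \<and> (f, p) = z \<otimes>\<^bsub>W r\<^esub> (h, t)"
    if "(f, p) \<in> carrier (W r)" "m \<ge> 2" "m \<le> r" "\<And>i. i > m \<Longrightarrow> p i = i" for m f p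
    using that(2,1,3,4)
  proof (induction m arbitrary: f p rule: dec_induct)
    case base
    have p: "p permutes {1..2}"
      by (rule permutes_superset[of p "{1..r}"]) (use base in \<open>auto simp: wreath_sym_carrier_iff\<close>)
    have "{1..2::nat} = {1, 2}" by auto
    then have "p = id \<or> p = transpose 1 2"
      using p by (simp add: permutes_doubleton_iff)
    then show ?case
      using base(1) by (intro bexI[OF _ N.one_closed] exI[of _ f] bexI[of _ p]) (auto simp: W.l_one)
  next
    case (step m)
    let ?m = "Suc m"
    have p: "p permutes {1..r}" using step.prems by (auto simp: wreath_sym_carrier_iff)
    show ?case
    proof (cases "p ?m = ?m")
      case True
      then have "p i = i" if "i > m" for i
        using that step.prems(3)[of i] by (cases "i = ?m") auto
      then show ?thesis
        using step.IH[OF step.prems(1) Suc_leD[OF step.prems(2)]] by blast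
    next
      case False
      define j where "j = Hilbert_Choice.inv p ?m"
      have pj: "p j = ?m" using p by (simp add: j_def permutes_inverses)
      have "j \<noteq> ?m" using pj False by auto
      moreover have "j \<le> ?m" using pj step.prems(3)[of j] by (cases "j > ?m") auto
      moreover have "j \<in> {1..r}" using pj permutes_in_image[OF p, of j] step.prems(2) by simp
      ultimately have j: "1 \<le> j" "j \<le> m" by auto
      define k where "k = (if j = 1 then 2 else 1::nat)"
      have k: "1 \<le> k" "k \<le> m" "k \<noteq> j" using step.hyps by (auto simp: k_def)
      let ?c = "transpose ?m k \<circ> transpose ?m j"
      have cN: "(\<lambda>_. \<one>, ?c) \<in> N"
        using three_cycle_move[OF c, of ?m k j] r j k step.prems by auto
      have cp: "?c permutes {1..r}" using in_carrier[OF cN] by (simp add: perm_carrier_iff)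
      have eq: "(\<lambda>_. \<one>, ?c) \<otimes>\<^bsub>W r\<^esub> (f, p) = (f \<circ> ?c, p \<circ> ?c)"
        using step.prems(1) by (simp add: wreath_sym_carrier_iff o_def)
      have car: "(f \<circ> ?c, p \<circ> ?c) \<in> carrier (W r)"
        unfolding eq[symmetric] using step.prems(1) in_carrier[OF cN] by blast
      have "(p \<circ> ?c) i = i" if "i > m" for i
      proof (cases "i = ?m")
        case True
        then show ?thesis using k j pj by (simp add: transpose_def)
      next
        case False
        then show ?thesis using that step.prems(3)[of i] j k by (simp add: transpose_def)
      qed
      then obtain z h t where z: "z \<in> N" and t: "t \<in> {id, transpose 1 2}" and h: "(h, t) \<in> carrier (W r)"
        "(f \<circ> ?c, p \<circ> ?c) = z \<otimes>\<^bsub>W r\<^esub> (h, t)"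
        using step.IH[OF car Suc_leD[OF step.prems(2)]] by blast
      have "(f, p) = inv\<^bsub>W r\<^esub> (\<lambda>_. \<one>, ?c) \<otimes>\<^bsub>W r\<^esub> (z \<otimes>\<^bsub>W r\<^esub> (h, t))"
        using eq h(2) W.inv_solve_left[OF step.prems(1) in_carrier[OF cN] car] by simp
      also have "\<dots> = inv\<^bsub>W r\<^esub> (\<lambda>_. \<one>, ?c) \<otimes>\<^bsub>W r\<^esub> z \<otimes>\<^bsub>W r\<^esub> (h, t)"
        using W.m_assoc[OF W.inv_closed[OF in_carrier[OF cN]] in_carrier[OF z] h(1)] by (rule sym)
      finally have "(f, p) = inv\<^bsub>W r\<^esub> (\<lambda>_. \<one>, ?c) \<otimes>\<^bsub>W r\<^esub> z \<otimes>\<^bsub>W r\<^esub> (h, t)" .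
      then show ?thesis using h(1) t N.m_closed[OF N.m_inv_closed[OF cN] z] by blast
    qed
  qed
  note reduce = this
  have "p i = i" if "i > r" for i
    using x that by (auto simp: wreath_sym_carrier_iff intro: permutes_not_in)
  then obtain z h t where z: "z \<in> N" and t: "t \<in> {id, transpose 1 2}" and h: "(h, t) \<in> carrier (W r)"
        "(f, p) = z \<otimes>\<^bsub>W r\<^esub> (h, t)"
    using reduce[of f p r] x r by auto
  obtain z' u where z': "z' \<in> N" "u \<in> carrier G" "(h, t) = z' \<otimes>\<^bsub>W r\<^esub> (single G 1 u, t)"
    using coset_of_single[OF _ _ h(1), of 1] antipodal_of_nontrivial_perm[OF c ne r] r by auto
  have "t permutes {1..r}" using h(1) by (simp add: wreath_sym_carrier_iff)
  then have "(single G 1 u, t) \<in> carrier (W r)"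
    using z'(2) r by (intro single_carrier) auto
  then have "(f, p) = z \<otimes>\<^bsub>W r\<^esub> z' \<otimes>\<^bsub>W r\<^esub> (single G 1 u, t)"
    using W.m_assoc[OF in_carrier[OF z] in_carrier[OF z'(1)]] h(2) z'(3) by (simp only:)
  then show ?thesis using N.m_closed[OF z z'(1)] z'(2) t by blast
qed

end

text \<open>A normal subgroup is determined by the probes it contains once \<open>r \<ge> 5\<close>, and the number of
  probes is bounded in terms of the order of \<open>G\<close>. The three-cycle tells whether the subgroup lies in
  the base group; the first kind of probe serves if it does not, the next two if it does.\<close>

definition probes :: "('a, 'b) monoid_scheme \<Rightarrow> nat \<Rightarrow> ((nat \<Rightarrow> 'a) \<times> (nat \<Rightarrow> nat)) set" where
  "probes G r =
     (\<lambda>(u, t). (single G 1 u, t)) ` (carrier G \<times> {id, transpose 1 2}) \<union>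
     (\<lambda>(u, v). (almost_constant G r u v, id)) ` (carrier G \<times> carrier G) \<union>
     (\<lambda>u. (antipodal G 1 2 u, id)) ` carrier G \<union>
     {(\<lambda>_. \<one>\<^bsub>G\<^esub>, transpose 1 2 \<circ> transpose 1 3)}"

lemma probes_finite: "finite (carrier G) \<Longrightarrow> finite (probes G r)"
  by (simp add: probes_def)

lemma card_probes_le:
  assumes "finite (carrier G)"
  shows "card (probes G r) \<le> card (carrier G) * 2 + card (carrier G) * card (carrier G) + card (carrier G) + 1"
proof -
  have "card {id, transpose 1 2 :: nat \<Rightarrow> nat} \<le> 2"
    by (simp add: card_insert_if)
  then have "card ((\<lambda>(u, t :: nat \<Rightarrow> nat). (single G 1 u, t)) ` (carrier G \<times> {id, transpose 1 2})) \<le> card (carrier G) * 2"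
    using assms by (intro order_trans[OF card_image_le]) (auto simp: card_cartesian_product)
  moreover have "card ((\<lambda>(u, v). (almost_constant G r u v, id :: nat \<Rightarrow> nat)) ` (carrier G \<times> carrier G))
      \<le> card (carrier G) * card (carrier G)"
    using assms by (intro order_trans[OF card_image_le]) (auto simp: card_cartesian_product)
  moreover have "card ((\<lambda>u. (antipodal G 1 2 u, id :: nat \<Rightarrow> nat)) ` carrier G) \<le> card (carrier G)"
    using assms by (rule card_image_le)
  ultimately show ?thesis
    unfolding probes_def by (intro order_trans[OF card_Un_le] add_mono) auto
qed

context group
begin

lemma normal_Int:
  assumes "N \<lhd> G" "N' \<lhd> G"
  shows "N \<inter> N' \<lhd> G"
  using assms by (auto simp: normal_inv_iff subgroups_Inter_pair)

lemma wreath_normalI: "N \<lhd> W r \<Longrightarrow> wreath_normal G r N"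
  by (intro wreath_normal.intro wreath_normal_axioms.intro group_axioms)

text \<open>Work modulo the intersection of both subgroups. If the three-cycle probe lies in it, then every
  element is congruent to a probe of the first kind. Otherwise both subgroups lie in the base group,
  quotients of two entries give antipodal probes, and every element is congruent to an almost constant
  tuple. In either case the element and the probe belong to the same of the two subgroups.\<close>

lemma normal_subset_of_probes:
  assumes N: "N \<lhd> W r" and N': "N' \<lhd> W r" and r: "r \<ge> 5"
    and eq: "N \<inter> probes G r = N' \<inter> probes G r"
  shows "N \<subseteq> N'"
proof
  interpret N: wreath_normal G r N by (rule wreath_normalI[OF N])
  interpret N': wreath_normal G r N' by (rule wreath_normalI[OF N'])
  interpret Z: wreath_normal G r "N \<inter> N'"
    by (rule wreath_normalI[OF group.normal_Int[OF wreath_sym_group N N']])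
  fix x assume x: "x \<in> N"
  then have xc: "x \<in> carrier (W r)" by (rule N.in_carrier)
  obtain f p where fp: "x = (f, p)" by force
  have "\<exists>z\<in>N \<inter> N'. \<exists>y\<in>probes G r. x = z \<otimes>\<^bsub>W r\<^esub> y"
  proof (cases "(\<lambda>_. \<one>, transpose 1 2 \<circ> transpose 1 3) \<in> N")
    case True
    then have "(\<lambda>_. \<one>, transpose 1 2 \<circ> transpose 1 3) \<in> N \<inter> N'"
      using eq by (auto simp: probes_def)
    from Z.coset_of_transposition[OF this _ xc[unfolded fp]] r
    obtain z u t where "z \<in> N \<inter> N'" "u \<in> carrier G" "t \<in> {id, transpose 1 2}"
      "x = z \<otimes>\<^bsub>W r\<^esub> (single G 1 u, t)" unfolding fp by auto
    moreover have "(single G 1 u, t) \<in> probes G r"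
      using calculation unfolding probes_def by (intro UnI1) force
    ultimately show ?thesis by blast
  next
    case False
    then have p: "p = id"
      using N.three_cycle_of_nontrivial_perm[of f p] x r fp by auto
    have f: "f j \<in> carrier G" for j
      using xc by (simp add: fp wreath_sym_carrier_iff)
    have "(antipodal G 1 j (f 2 \<otimes> inv f j), id) \<in> N \<inter> N'" if j: "j \<in> {3..r}" for j
    proof -
      have "(antipodal G 2 j (f 2 \<otimes> inv f j), id) \<in> N"
        using x r j by (intro N.base_coord_quotient) (auto simp: fp p)
      then have "(antipodal G 1 2 (f 2 \<otimes> inv f j), id) \<in> N"
        by (rule N.antipodal_move) (use r j in auto)
      moreover have "(antipodal G 1 2 (f 2 \<otimes> inv f j), id) \<in> probes G r"
        using f unfolding probes_def by (intro UnI1[OF UnI2]) auto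
      ultimately have "(antipodal G 1 2 (f 2 \<otimes> inv f j), id) \<in> N \<inter> N'"
        using eq by blast
      then show ?thesis
        by (rule Z.antipodal_move) (use r j in auto)
    qed
    from Z.coset_of_almost_constant[OF this] r xc
    obtain z u v where "z \<in> N \<inter> N'" "u \<in> carrier G" "v \<in> carrier G"
      "x = z \<otimes>\<^bsub>W r\<^esub> (almost_constant G r u v, id)" unfolding fp p by auto
    moreover have "(almost_constant G r u v, id) \<in> probes G r"
      using calculation unfolding probes_def by (intro UnI1[OF UnI1[OF UnI2]]) force
    ultimately show ?thesis by blast
  qed
  then obtain z y where z: "z \<in> N \<inter> N'" and y: "y \<in> probes G r" and xzy: "x = z \<otimes>\<^bsub>W r\<^esub> y" by blast
  have "y \<in> carrier (W r)"
    using y r by (auto simp: probes_def permutes_id intro!: single_carrier antipodal_carrier permutes_swap_id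
        permutes_compose) (auto simp: wreath_sym_carrier_iff almost_constant_def permutes_id
          intro!: permutes_compose permutes_swap_id)
  then have "y = inv\<^bsub>W r\<^esub> z \<otimes>\<^bsub>W r\<^esub> x"
    using xzy N.W.inv_solve_left[OF _ Z.in_carrier[OF z] xc] by blast
  then have "y \<in> N"
    using N.N.m_closed[OF N.N.m_inv_closed x] z by blast
  then show "x \<in> N'"
    using y eq xzy z by blast
qed

lemma wreath_sym_finite:
  assumes "finite (carrier G)"
  shows "finite (carrier (W r))"
proof (rule finite_subset)
  show "carrier (W r) \<subseteq>
      (\<lambda>h i. if i \<in> {1..r} then h i else \<one>) ` ({1..r} \<rightarrow>\<^sub>E carrier G) \<times> {p. p permutes {1..r}}"
  proof
    fix x assume "x \<in> carrier (W r)"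
    then show "x \<in> (\<lambda>h i. if i \<in> {1..r} then h i else \<one>) ` ({1..r} \<rightarrow>\<^sub>E carrier G) \<times> {p. p permutes {1..r}}"
      by (cases x) (auto simp: wreath_sym_carrier_iff fun_eq_iff
          intro!: image_eqI[where x = "restrict (fst x) {1..r}"])
  qed
  show "finite ((\<lambda>h i. if i \<in> {1..r} then h i else \<one>) ` ({1..r} \<rightarrow>\<^sub>E carrier G) \<times> {p. p permutes {1..r}})"
    using assms by (simp add: finite_PiE finite_permutations)
qed

lemma finite_wreath_normals:
  assumes "finite (carrier G)"
  shows "finite {N. N \<lhd> W r}"
  by (rule finite_subset[of _ "Pow (carrier (W r))"])
     (auto dest!: normal_imp_subgroup subgroup.subset simp: wreath_sym_finite assms)

text \<open>The wreath products with fewer than five positions are finitely many finite groups.\<close>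

lemma card_wreath_normals_bounded:
  assumes "finite (carrier G)"
  shows "\<exists>B. \<forall>r. card {N. N \<lhd> W r} \<le> B"
proof -
  let ?m = "card (carrier G) * 2 + card (carrier G) * card (carrier G) + card (carrier G) + 1"
  let ?s = "\<Sum>r<5. card {N. N \<lhd> W r}"
  have "card {N. N \<lhd> W r} \<le> ?s + 2 ^ ?m" for r
  proof (cases "r < 5")
    case True
    then have "card {N. N \<lhd> W r} \<le> ?s"
      by (intro member_le_sum) auto
    then show ?thesis by simp
  next
    case False
    have "card {N. N \<lhd> W r} \<le> card (Pow (probes G r))"
    proof (rule card_inj_on_le)
      show "inj_on (\<lambda>N. N \<inter> probes G r) {N. N \<lhd> W r}"
        using False normal_subset_of_probes[of _ r] by (intro inj_onI) (auto simp: not_less)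
    qed (use assms in \<open>auto simp: probes_finite\<close>)
    also have "\<dots> \<le> 2 ^ ?m"
      unfolding card_Pow[OF probes_finite[OF assms]] using card_probes_le[OF assms] by (rule power_increasing) simp
    finally show ?thesis by simp
  qed
  then show ?thesis by blast
qed

end

section \<open>Elements of the wreath product as monomial maps\<close>

text \<open>In terms of total functions with an explicit domain, multiplication becomes composition of
  functions, and equality becomes equality on the domain.\<close>

definition monomial :: "nat set \<Rightarrow> (nat \<Rightarrow> 'a) \<Rightarrow> (nat \<Rightarrow> nat) \<Rightarrow> (nat \<Rightarrow> 'a option) \<times> (nat \<rightharpoonup> nat)" where
  "monomial A f p = ((\<lambda>i. if i \<in> A then Some (f i) else None), (\<lambda>i. if i \<in> A then Some (p i) else None))"

definition partial_id :: "('a, 'b) monoid_scheme \<Rightarrow> nat set \<Rightarrow> (nat \<Rightarrow> 'a option) \<times> (nat \<rightharpoonup> nat)" where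
  "partial_id G A = monomial A (\<lambda>_. \<one>\<^bsub>G\<^esub>) id"

definition partial_inverse :: "('a, 'b) monoid_scheme \<Rightarrow> nat set \<Rightarrow> (nat \<Rightarrow> 'a) \<Rightarrow> (nat \<Rightarrow> nat)
    \<Rightarrow> (nat \<Rightarrow> 'a option) \<times> (nat \<rightharpoonup> nat)" where
  "partial_inverse G A f p = monomial (p ` A) (\<lambda>j. inv\<^bsub>G\<^esub> f (inv_into A p j)) (inv_into A p)"

lemma monomial_eq_iff: "monomial A f p = monomial B h s \<longleftrightarrow> A = B \<and> (\<forall>i\<in>A. f i = h i \<and> p i = s i)"
  by (auto simp: monomial_def fun_eq_iff split: if_splits)

lemma monomial_mult:
  "monomial A f p \<otimes>\<^bsub>wreath_sym_inv G n\<^esub> monomial B h s =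
     monomial {i \<in> A. p i \<in> B} (\<lambda>i. f i \<otimes>\<^bsub>G\<^esub> h (p i)) (\<lambda>i. s (p i))"
  by (auto simp: wreath_sym_inv_def monomial_def adjoin_zero_def tuple_act_def sym_inv_monoid_def
      map_comp_def fun_eq_iff)

lemma monomial_carrier_iff:
  "monomial A f p \<in> carrier (wreath_sym_inv G n) \<longleftrightarrow>
     A \<subseteq> {1..n} \<and> inj_on p A \<and> p ` A \<subseteq> {1..n} \<and> f ` A \<subseteq> carrier G"
proof -
  have [simp]: "dom (\<lambda>i. if i \<in> A then Some (p i) else None) = A"
    by (auto simp: dom_def)
  have [simp]: "ran (\<lambda>i. if i \<in> A then Some (p i) else None) = p ` A"
    by (auto simp: ran_def)
  have [simp]: "inj_on (\<lambda>i. if i \<in> A then Some (p i) else None) A = inj_on p A"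
    by (auto simp: inj_on_def)
  show ?thesis
    by (auto simp: wreath_sym_inv_def monomial_def adjoin_zero_def zero_tuples_def sym_inv_monoid_def)
qed

lemma carrier_monomialE:
  assumes "x \<in> carrier (wreath_sym_inv G n)"
  obtains A f p where "x = monomial A f p"
proof -
  obtain g a where x: "x = (g, a)" by force
  have "(g i \<noteq> None) = (i \<in> dom a)" for i
    using assms by (cases "i \<in> {1..n}") (auto simp: x wreath_sym_inv_def zero_tuples_def sym_inv_monoid_def)
  then have "x = monomial (dom a) (\<lambda>i. the (g i)) (\<lambda>i. the (a i))"
    by (force simp: x monomial_def fun_eq_iff)
  then show thesis by (rule that)
qed

lemma partial_id_carrier: "group G \<Longrightarrow> partial_id G A \<in> carrier (wreath_sym_inv G n) \<longleftrightarrow> A \<subseteq> {1..n}"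
  by (auto simp: partial_id_def monomial_carrier_iff group.is_monoid monoid.one_closed)

context group
begin

abbreviation "S \<equiv> wreath_sym_inv G"
abbreviation "E \<equiv> partial_id G"

lemma partial_id_mult [simp]: "E A \<otimes>\<^bsub>S n\<^esub> E B = E (A \<inter> B)"
  by (auto simp: partial_id_def monomial_mult monomial_eq_iff)

lemma partial_id_mult_monomial:
  "f ` A \<subseteq> carrier G \<Longrightarrow> E B \<otimes>\<^bsub>S n\<^esub> monomial A f p = monomial (A \<inter> B) f p"
  by (auto simp: partial_id_def monomial_mult monomial_eq_iff)

lemma monomial_mult_partial_id:
  "f ` A \<subseteq> carrier G \<Longrightarrow> monomial A f p \<otimes>\<^bsub>S n\<^esub> E B = monomial {i \<in> A. p i \<in> B} f p"
  by (auto simp: partial_id_def monomial_mult monomial_eq_iff)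

lemma partial_inverse_carrier:
  assumes "monomial A f p \<in> carrier (S n)"
  shows "partial_inverse G A f p \<in> carrier (S n)"
  using assms by (auto simp: partial_inverse_def monomial_carrier_iff inj_on_inv_into)

lemma mult_partial_inverse:
  assumes "monomial A f p \<in> carrier (S n)"
  shows "monomial A f p \<otimes>\<^bsub>S n\<^esub> partial_inverse G A f p = E A"
  using assms by (auto simp: partial_inverse_def monomial_carrier_iff monomial_mult partial_id_def monomial_eq_iff)

lemma wreath_sym_inv_closed:
  assumes "x \<in> carrier (S n)" "y \<in> carrier (S n)"
  shows "x \<otimes>\<^bsub>S n\<^esub> y \<in> carrier (S n)"
proof -
  obtain A f p B h s where xy: "x = monomial A f p" "y = monomial B h s"
    using assms by (metis carrier_monomialE)
  show ?thesis
    using assms unfolding xy monomial_mult monomial_carrier_iff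
    by (auto simp: inj_on_def image_subset_iff)
qed

definition unit_embedding :: "nat \<Rightarrow> (nat \<Rightarrow> 'a) \<times> (nat \<Rightarrow> nat) \<Rightarrow> (nat \<Rightarrow> 'a option) \<times> (nat \<rightharpoonup> nat)" where
  "unit_embedding r x = monomial {1..r} (fst x) (snd x)"

lemma unit_embedding_carrier:
  "r \<le> n \<Longrightarrow> x \<in> carrier (W r) \<Longrightarrow> unit_embedding r x \<in> carrier (S n)"
  by (cases x) (auto simp: unit_embedding_def wreath_sym_carrier_iff monomial_carrier_iff permutes_inj_on
      dest: permutes_in_image[THEN iffD2])

lemma unit_embedding_mult:
  "x \<in> carrier (W r) \<Longrightarrow> y \<in> carrier (W r) \<Longrightarrow>
     unit_embedding r (x \<otimes>\<^bsub>W r\<^esub> y) = unit_embedding r x \<otimes>\<^bsub>S n\<^esub> unit_embedding r y"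
  by (cases x; cases y)
     (auto simp: unit_embedding_def wreath_sym_carrier_iff monomial_mult monomial_eq_iff dest: permutes_in_image)

lemma unit_embedding_one: "unit_embedding r \<one>\<^bsub>W r\<^esub> = E {1..r}"
  by (simp add: unit_embedding_def wreath_sym_one partial_id_def)

lemma unit_embedding_inv:
  assumes "x \<in> carrier (W r)"
  shows "unit_embedding r x \<otimes>\<^bsub>S n\<^esub> unit_embedding r (inv\<^bsub>W r\<^esub> x) = E {1..r}"
proof -
  interpret W: group "W r" by (rule wreath_sym_group)
  show ?thesis
    using assms by (simp add: unit_embedding_mult[symmetric] unit_embedding_one)
qed

end

section \<open>The structure of a congruence\<close>

locale wreath_congruence = group G for G (structure) +
  fixes n :: nat and \<rho> :: "(((nat \<Rightarrow> 'a option) \<times> (nat \<rightharpoonup> nat)) \<times> ((nat \<Rightarrow> 'a option) \<times> (nat \<rightharpoonup> nat))) set"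
  assumes congruence: "\<rho> \<in> congruences (wreath_sym_inv G n)"
begin

lemma equivalence: "equiv (carrier (S n)) \<rho>"
  using congruence by (simp add: congruences_def semigroup_congruence_def)

lemma related_carrier: "(x, y) \<in> \<rho> \<Longrightarrow> x \<in> carrier (S n)" "(x, y) \<in> \<rho> \<Longrightarrow> y \<in> carrier (S n)"
  using equivalence by (auto simp: equiv_def refl_on_def)

lemma related_refl: "x \<in> carrier (S n) \<Longrightarrow> (x, x) \<in> \<rho>"
  using equivalence by (auto simp: equiv_def refl_on_def)

lemma related_sym: "(x, y) \<in> \<rho> \<Longrightarrow> (y, x) \<in> \<rho>"
  using equivalence by (auto simp: equiv_def dest: symD)

lemma related_trans [trans]: "(x, y) \<in> \<rho> \<Longrightarrow> (y, z) \<in> \<rho> \<Longrightarrow> (x, z) \<in> \<rho>"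
  using equivalence by (auto simp: equiv_def dest: transD)

lemma related_mult_left: "(x, y) \<in> \<rho> \<Longrightarrow> z \<in> carrier (S n) \<Longrightarrow> (z \<otimes>\<^bsub>S n\<^esub> x, z \<otimes>\<^bsub>S n\<^esub> y) \<in> \<rho>"
  using congruence unfolding congruences_def semigroup_congruence_def by blast

lemma related_mult_right: "(x, y) \<in> \<rho> \<Longrightarrow> z \<in> carrier (S n) \<Longrightarrow> (x \<otimes>\<^bsub>S n\<^esub> z, y \<otimes>\<^bsub>S n\<^esub> z) \<in> \<rho>"
  using congruence unfolding congruences_def semigroup_congruence_def by blast

lemma E_carrier: "A \<subseteq> {1..n} \<Longrightarrow> E A \<in> carrier (S n)"
  by (simp add: partial_id_carrier group_axioms)

text \<open>Conjugation by transpositions inside \<open>A\<close> shows that any point of \<open>A\<close> can be erased in place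
  of \<open>i\<close>; then the points are erased one after another.\<close>

lemma collapse_of_erase:
  assumes A: "A \<subseteq> {1..n}" and i: "i \<in> A" and rel: "(E A, E (A - {i})) \<in> \<rho>"
  shows "(E A, E {}) \<in> \<rho>"
proof -
  have erase: "(E A, E (A - {j})) \<in> \<rho>" if j: "j \<in> A" for j
  proof -
    let ?t = "monomial A (\<lambda>_. \<one>) (transpose i j)"
    have t: "transpose i j k \<in> A \<longleftrightarrow> k \<in> A" for k
      using i j by (auto simp: transpose_def)
    have tc: "?t \<in> carrier (S n)"
      using A t by (auto simp: monomial_carrier_iff)
    have "(?t \<otimes>\<^bsub>S n\<^esub> E A \<otimes>\<^bsub>S n\<^esub> ?t, ?t \<otimes>\<^bsub>S n\<^esub> E (A - {i}) \<otimes>\<^bsub>S n\<^esub> ?t) \<in> \<rho>"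
      using rel tc by (intro related_mult_left related_mult_right)
    moreover have "?t \<otimes>\<^bsub>S n\<^esub> E A \<otimes>\<^bsub>S n\<^esub> ?t = E A"
      by (auto simp: partial_id_def monomial_mult monomial_eq_iff t)
    moreover have "transpose i j k = i \<longleftrightarrow> k = j" for k
      by (auto simp: transpose_def)
    then have "?t \<otimes>\<^bsub>S n\<^esub> E (A - {i}) \<otimes>\<^bsub>S n\<^esub> ?t = E (A - {j})"
      by (auto simp: partial_id_def monomial_mult monomial_eq_iff t)
    ultimately show ?thesis by simp
  qed
  have "(E A, E (A - B)) \<in> \<rho>" if "finite B" "B \<subseteq> A" for B
    using that
  proof (induction B rule: finite_induct)
    case empty
    then show ?case using related_refl[OF E_carrier[OF A]] by simp
  next
    case (insert j B)
    have "(E (A - B) \<otimes>\<^bsub>S n\<^esub> E A, E (A - B) \<otimes>\<^bsub>S n\<^esub> E (A - {j})) \<in> \<rho>"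
      using A insert.prems by (intro related_mult_left erase E_carrier) auto
    moreover have "(A - B) \<inter> A = A - B" "(A - B) \<inter> (A - {j}) = A - insert j B" by auto
    ultimately have "(E (A - B), E (A - insert j B)) \<in> \<rho>" by simp
    moreover have "(E A, E (A - B)) \<in> \<rho>" using insert by simp
    ultimately show ?case by (rule related_trans[rotated])
  qed
  from this[of A] show ?thesis
    using finite_subset[OF A] by simp
qed

text \<open>An element of rank at most the rank of \<open>E A\<close> factors through \<open>E A\<close>.\<close>

lemma collapse_of_card_le:
  assumes rel: "(E A, E {}) \<in> \<rho>" and A: "A \<subseteq> {1..n}"
    and x: "monomial B f p \<in> carrier (S n)" and card: "card B \<le> card A"
  shows "(monomial B f p, E {}) \<in> \<rho>"
proof -
  have B: "B \<subseteq> {1..n}" and p: "inj_on p B" "p ` B \<subseteq> {1..n}" and f: "f ` B \<subseteq> carrier G"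
    using x by (auto simp: monomial_carrier_iff)
  have fin: "finite A" "finite B" using A B finite_subset by blast+
  obtain b where b: "b ` B \<subseteq> A" "inj_on b B"
    using card_le_inj[OF fin(2,1) card] by blast
  let ?x = "monomial B (\<lambda>_. \<one>) b"
  let ?y = "monomial (b ` B) (\<lambda>i. f (inv_into B b i)) (\<lambda>i. p (inv_into B b i))"
  have xc: "?x \<in> carrier (S n)"
    using A B b by (auto simp: monomial_carrier_iff)
  have yc: "?y \<in> carrier (S n)"
    using A b p f by (auto simp: monomial_carrier_iff inj_on_def image_subset_iff)
  have "(?x \<otimes>\<^bsub>S n\<^esub> E A \<otimes>\<^bsub>S n\<^esub> ?y, ?x \<otimes>\<^bsub>S n\<^esub> E {} \<otimes>\<^bsub>S n\<^esub> ?y) \<in> \<rho>"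
    using rel xc yc by (intro related_mult_left related_mult_right)
  moreover have "?x \<otimes>\<^bsub>S n\<^esub> E A \<otimes>\<^bsub>S n\<^esub> ?y = monomial B f p"
    using b f by (auto simp: partial_id_def monomial_mult monomial_eq_iff)
  moreover have "?x \<otimes>\<^bsub>S n\<^esub> E {} \<otimes>\<^bsub>S n\<^esub> ?y = E {}"
    by (auto simp: partial_id_def monomial_mult monomial_eq_iff)
  ultimately show ?thesis by simp
qed

lemma collapse_iff_domain:
  assumes x: "monomial A f p \<in> carrier (S n)"
  shows "(monomial A f p, E {}) \<in> \<rho> \<longleftrightarrow> (E A, E {}) \<in> \<rho>"
proof
  assume "(monomial A f p, E {}) \<in> \<rho>"
  moreover have "E {} \<otimes>\<^bsub>S n\<^esub> partial_inverse G A f p = E {}"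
    by (simp add: partial_inverse_def partial_id_def monomial_mult monomial_eq_iff)
  ultimately show "(E A, E {}) \<in> \<rho>"
    using related_mult_right[OF _ partial_inverse_carrier[OF x]] mult_partial_inverse[OF x] by metis
next
  assume "(E A, E {}) \<in> \<rho>"
  then show "(monomial A f p, E {}) \<in> \<rho>"
    using x by (intro collapse_of_card_le[of A]) (auto simp: monomial_carrier_iff)
qed

text \<open>The elements that are congruent to zero are those of rank at most \<open>level\<close>; above this rank
  the congruence is contained in Green's relation \<open>\<H>\<close>, since it preserves domain and image.\<close>

definition level :: nat where
  "level = Max {k. k \<le> n \<and> (E {1..k}, E {}) \<in> \<rho>}"

lemma level_le: "level \<le> n" and level_collapse: "(E {1..level}, E {}) \<in> \<rho>"
proof -
  have "0 \<in> {k. k \<le> n \<and> (E {1..k}, E {}) \<in> \<rho>}"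
    using related_refl[OF E_carrier, of "{}"] by simp
  then have "level \<in> {k. k \<le> n \<and> (E {1..k}, E {}) \<in> \<rho>}"
    unfolding level_def by (intro Max_in) auto
  then show "level \<le> n" "(E {1..level}, E {}) \<in> \<rho>" by auto
qed

lemma collapse_iff_level:
  assumes x: "monomial A f p \<in> carrier (S n)"
  shows "(monomial A f p, E {}) \<in> \<rho> \<longleftrightarrow> card A \<le> level"
proof
  assume "card A \<le> level"
  then show "(monomial A f p, E {}) \<in> \<rho>"
    using level_le by (intro collapse_of_card_le[OF level_collapse _ x]) auto
next
  assume "(monomial A f p, E {}) \<in> \<rho>"
  then have "(E A, E {}) \<in> \<rho>" by (simp add: collapse_iff_domain[OF x])
  moreover have A: "A \<subseteq> {1..n}" using x by (simp add: monomial_carrier_iff)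
  moreover have card: "card A \<le> n" using card_mono[OF _ A] by simp
  ultimately have "(E {1..card A}, E {}) \<in> \<rho>"
    unfolding partial_id_def[of G "{1..card A}"]
    by (intro collapse_of_card_le[of A]) (auto simp: monomial_carrier_iff)
  then show "card A \<le> level"
    unfolding level_def using card by (intro Max_ge) auto
qed

text \<open>If \<open>y\<close> misses a point \<open>i\<close> of the domain of \<open>x\<close>, then erasing \<open>i\<close> does not change
  \<open>y\<close>, so \<open>x\<close> is related to a proper restriction of itself, and the rank of \<open>x\<close> collapses.\<close>

lemma related_domain_subset:
  assumes rel: "(monomial A f p, monomial B h s) \<in> \<rho>" and "level < card A"
  shows "A \<subseteq> B"
proof (rule ccontr)
  assume "\<not> A \<subseteq> B"
  then obtain i where i: "i \<in> A" "i \<notin> B" by blast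
  note x = related_carrier(1)[OF rel] and y = related_carrier(2)[OF rel]
  have A: "A \<subseteq> {1..n}" and f: "f ` A \<subseteq> carrier G" and h: "h ` B \<subseteq> carrier G"
    using x y by (auto simp: monomial_carrier_iff)
  let ?e = "E ({1..n} - {i})"
  have "?e \<otimes>\<^bsub>S n\<^esub> monomial B h s = monomial B h s"
    using i y h by (auto simp: partial_id_mult_monomial monomial_eq_iff monomial_carrier_iff)
  moreover have "?e \<otimes>\<^bsub>S n\<^esub> monomial A f p = monomial (A - {i}) f p"
    using A f by (auto simp: partial_id_mult_monomial monomial_eq_iff)
  moreover have "(?e \<otimes>\<^bsub>S n\<^esub> monomial A f p, ?e \<otimes>\<^bsub>S n\<^esub> monomial B h s) \<in> \<rho>"
    using rel by (intro related_mult_left E_carrier) auto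
  ultimately have "(monomial (A - {i}) f p, monomial B h s) \<in> \<rho>" by simp
  then have "(monomial A f p, monomial (A - {i}) f p) \<in> \<rho>"
    using rel related_sym related_trans by blast
  from related_mult_right[OF this partial_inverse_carrier[OF x]]
  have "(E A, monomial (A - {i}) f p \<otimes>\<^bsub>S n\<^esub> partial_inverse G A f p) \<in> \<rho>"
    by (simp add: mult_partial_inverse[OF x])
  moreover have "monomial (A - {i}) f p \<otimes>\<^bsub>S n\<^esub> partial_inverse G A f p = E (A - {i})"
    using x by (auto simp: partial_inverse_def partial_id_def monomial_mult monomial_eq_iff monomial_carrier_iff)
  ultimately have "(E A, E {}) \<in> \<rho>"
    using collapse_of_erase[OF A i(1)] by simp
  then have "(monomial A f p, E {}) \<in> \<rho>"
    by (simp add: collapse_iff_domain[OF x])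
  then show False
    using assms(2) collapse_iff_level[OF x] by simp
qed

lemma related_image_subset:
  assumes rel: "(monomial A f p, monomial B h s) \<in> \<rho>" and "level < card A"
  shows "p ` A \<subseteq> s ` B"
proof (rule ccontr)
  assume "\<not> p ` A \<subseteq> s ` B"
  then obtain i where i: "i \<in> A" "p i \<notin> s ` B" by blast
  note x = related_carrier(1)[OF rel] and y = related_carrier(2)[OF rel]
  have A: "A \<subseteq> {1..n}" and f: "f ` A \<subseteq> carrier G" and h: "h ` B \<subseteq> carrier G"
    using x y by (auto simp: monomial_carrier_iff)
  let ?e = "E ({1..n} - {p i})"
  have "s j \<noteq> p i" if "j \<in> B" for j using i that by (metis imageI)
  then have "monomial B h s \<otimes>\<^bsub>S n\<^esub> ?e = monomial B h s"
    using y h by (auto simp: monomial_mult_partial_id monomial_eq_iff monomial_carrier_iff)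
  moreover have "monomial A f p \<otimes>\<^bsub>S n\<^esub> ?e = monomial (A - {i}) f p"
    using x i f by (auto simp: monomial_mult_partial_id monomial_eq_iff monomial_carrier_iff dest: inj_onD)
  moreover have "(monomial A f p \<otimes>\<^bsub>S n\<^esub> ?e, monomial B h s \<otimes>\<^bsub>S n\<^esub> ?e) \<in> \<rho>"
    using rel by (intro related_mult_right E_carrier) auto
  ultimately have "(monomial (A - {i}) f p, monomial B h s) \<in> \<rho>" by simp
  then have "(monomial A f p, monomial (A - {i}) f p) \<in> \<rho>"
    using rel related_sym related_trans by blast
  then show False
    using related_domain_subset assms(2) i(1) by blast
qed

lemma related_same_domain_image:
  assumes rel: "(monomial A f p, monomial B h s) \<in> \<rho>" and "level < card A"
  shows "A = B" "p ` A = s ` B"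
proof -
  note x = related_carrier(1)[OF rel] and y = related_carrier(2)[OF rel]
  have "(monomial B h s, E {}) \<notin> \<rho>"
    using related_trans[OF rel, of "E {}"] assms(2) collapse_iff_level[OF x] by linarith
  then have "level < card B" using collapse_iff_level[OF y] by simp
  then show "A = B" "p ` A = s ` B"
    using related_domain_subset[OF rel] related_domain_subset[OF related_sym[OF rel]]
      related_image_subset[OF rel] related_image_subset[OF related_sym[OF rel]] assms(2) by auto
qed

end

text \<open>Two normal subgroups of \<open>G\<close> that are attached to a normal subgroup \<open>N\<close> of the wreath product:
  the projection of the base part of \<open>N\<close> onto a coordinate, and its intersection with a
  coordinate subgroup. Both are independent of the coordinate because \<open>N\<close> is normal.\<close>

definition first_coords :: "((nat \<Rightarrow> 'a) \<times> (nat \<Rightarrow> nat)) set \<Rightarrow> 'a set" where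
  "first_coords N = {f 1 | f. (f, id) \<in> N}"

definition axis :: "('a, 'b) monoid_scheme \<Rightarrow> ((nat \<Rightarrow> 'a) \<times> (nat \<Rightarrow> nat)) set \<Rightarrow> 'a set" where
  "axis G N = {g \<in> carrier G. (single G 1 g, id) \<in> N}"

context wreath_normal
begin

lemma base_coord_closed: "(f, id) \<in> N \<Longrightarrow> f i \<in> carrier G"
  using in_carrier[of "(f, id)"] by (simp add: wreath_sym_carrier_iff)

lemma base_mult: "(f, id) \<in> N \<Longrightarrow> (h, id) \<in> N \<Longrightarrow> (\<lambda>i. f i \<otimes> h i, id) \<in> N"
  using N.m_closed[of "(f, id)" "(h, id)"] by simp

lemma base_inv: "(f, id) \<in> N \<Longrightarrow> (\<lambda>i. inv f i, id) \<in> N"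
  using N.m_inv_closed[of "(f, id)"] wreath_sym_inv_elt[OF in_carrier, of f id] by simp

lemma base_conj:
  assumes "(f, id) \<in> N" "x \<in> carrier G" "r \<ge> 1"
  shows "(\<lambda>i. single G 1 x i \<otimes> f i \<otimes> inv single G 1 x i, id) \<in> N"
proof -
  have c: "(single G 1 x, id) \<in> carrier (W r)"
    using assms by (intro single_carrier permutes_id) auto
  show ?thesis
    using N.inv_op_closed2[OF c assms(1)] unfolding wreath_sym_inv_elt[OF c] by simp
qed

lemma first_coords_normal:
  assumes "r \<ge> 1"
  shows "first_coords N \<lhd> G"
  unfolding normal_inv_iff
proof (intro conjI ballI)
  show "subgroup (first_coords N) G"
  proof (rule subgroupI)
    show "first_coords N \<subseteq> carrier G"
      using base_coord_closed by (auto simp: first_coords_def)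
    show "first_coords N \<noteq> {}"
      using N.one_closed by (auto simp: first_coords_def wreath_sym_one)
    show "inv a \<in> first_coords N" if "a \<in> first_coords N" for a
      using that base_inv by (force simp: first_coords_def)
    show "a \<otimes> b \<in> first_coords N" if "a \<in> first_coords N" "b \<in> first_coords N" for a b
      using that base_mult by (force simp: first_coords_def)
  qed
  show "x \<otimes> h \<otimes> inv x \<in> first_coords N" if x: "x \<in> carrier G" and h: "h \<in> first_coords N" for x h
  proof -
    obtain f where f: "(f, id) \<in> N" "h = f 1" using h by (auto simp: first_coords_def)
    show ?thesis
      unfolding first_coords_def f(2)
      by (intro CollectI exI[of _ "\<lambda>i. single G 1 x i \<otimes> f i \<otimes> inv single G 1 x i"]
          conjI base_conj[OF f(1) x assms]) (simp add: single_def)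
  qed
qed

lemma axis_normal:
  assumes "r \<ge> 1"
  shows "axis G N \<lhd> G"
  unfolding normal_inv_iff
proof (intro conjI ballI)
  have single_mult: "(\<lambda>i. single G 1 a i \<otimes> single G 1 b i) = single G 1 (a \<otimes> b)"
    if "a \<in> carrier G" "b \<in> carrier G" for a b
    using that by (auto simp: single_def)
  have single_inv: "(\<lambda>i. inv single G 1 a i) = single G 1 (inv a)" for a
    by (auto simp: single_def)
  show "subgroup (axis G N) G"
  proof (rule subgroupI)
    show "axis G N \<subseteq> carrier G"
      by (auto simp: axis_def)
    have "single G 1 \<one> = (\<lambda>_. \<one>)" by (auto simp: single_def)
    then have "\<one> \<in> axis G N"
      using N.one_closed by (simp add: axis_def wreath_sym_one)
    then show "axis G N \<noteq> {}" by blast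
    show "inv a \<in> axis G N" if "a \<in> axis G N" for a
      using that base_inv[of "single G 1 a"] by (auto simp: axis_def single_inv simp del: One_nat_def)
    show "a \<otimes> b \<in> axis G N" if "a \<in> axis G N" "b \<in> axis G N" for a b
      using that base_mult[of "single G 1 a" "single G 1 b"] by (auto simp: axis_def single_mult simp del: One_nat_def)
  qed
  show "x \<otimes> h \<otimes> inv x \<in> axis G N" if x: "x \<in> carrier G" and h: "h \<in> axis G N" for x h
  proof -
    have hG: "h \<in> carrier G" and "(single G 1 h, id) \<in> N" using h by (auto simp: axis_def)
    then have "(\<lambda>i. single G 1 x i \<otimes> single G 1 h i \<otimes> inv single G 1 x i, id) \<in> N"
      using base_conj x assms by blast
    moreover have "(\<lambda>i. single G 1 x i \<otimes> single G 1 h i \<otimes> inv single G 1 x i) = single G 1 (x \<otimes> h \<otimes> inv x)"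
      using x hG by (auto simp: single_def)
    ultimately show ?thesis using x hG by (simp add: axis_def)
  qed
qed

lemma coord_in_first_coords:
  assumes "(f, id) \<in> N" "i \<in> {1..r}"
  shows "f i \<in> first_coords N"
proof -
  have "transpose 1 i permutes {1..r}"
    using assms(2) by (intro permutes_swap_id) auto
  from conj_perm[OF assms(1) this] have "(f \<circ> transpose 1 i, id) \<in> N"
    by (simp add: inv_swap_id)
  then show ?thesis
    unfolding first_coords_def by (intro CollectI exI[of _ "f \<circ> transpose 1 i"] conjI) simp_all
qed

lemma axis_power_subset:
  assumes m: "\<And>i. i \<in> {1..r} \<Longrightarrow> m i \<in> axis G N" "\<And>i. i \<notin> {1..r} \<Longrightarrow> m i = \<one>"
  shows "(m, id) \<in> N"
proof -
  have single: "(single G i g, id) \<in> N" if "g \<in> axis G N" "i \<in> {1..r}" for g i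
  proof -
    have "transpose 1 i permutes {1..r}"
      using that(2) by (intro permutes_swap_id) auto
    then have "(single G 1 g \<circ> transpose 1 i, id) \<in> N"
      using conj_perm[of "single G 1 g" id "transpose 1 i"] that(1) by (simp add: axis_def inv_swap_id)
    moreover have "single G 1 g \<circ> transpose 1 i = single G i g"
      by (auto simp: single_def fun_eq_iff transpose_def)
    ultimately show ?thesis by simp
  qed
  have mc: "m i \<in> carrier G" for i
    using m by (cases "i \<in> {1..r}") (auto simp: axis_def)
  have "(\<lambda>i. if i \<in> F then m i else \<one>, id) \<in> N" if "finite F" "F \<subseteq> {1..r}" for F
    using that
  proof (induction F rule: finite_induct)
    case empty
    then show ?case using N.one_closed unfolding wreath_sym_one by (simp only: empty_iff if_False)
  next
    case (insert k F)
    have "F \<subseteq> {1..r}" and k: "k \<in> {1..r}" using insert.prems by auto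
    have "(\<lambda>i. single G k (m k) i \<otimes> (if i \<in> F then m i else \<one>), id) \<in> N"
      by (rule base_mult[OF single[OF m(1)[OF k] k] insert.IH[OF \<open>F \<subseteq> {1..r}\<close>]])
    moreover have "(\<lambda>i. single G k (m k) i \<otimes> (if i \<in> F then m i else \<one>)) =
        (\<lambda>i. if i \<in> insert k F then m i else \<one>)"
      using insert.hyps mc by (auto simp: single_def)
    ultimately show ?case by (simp only:)
  qed
  from this[of "{1..r}"] have "(\<lambda>i. if i \<in> {1..r} then m i else \<one>, id) \<in> N" by simp
  also have "(\<lambda>i. if i \<in> {1..r} then m i else \<one>) = m"
    using m(2) by auto
  finally show ?thesis .
qed

text \<open>The hypotheses say that every tuple in \<open>N\<close> is constant modulo the axis. Conversely, a
  tuple \<open>f\<close> on the right-hand side shares its first entry with some \<open>h\<close> in \<open>N\<close>, and then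
  every entry of the quotient of \<open>f\<close> by \<open>h\<close> lies in the axis.\<close>

lemma base_subgroup_eq:
  assumes base: "\<And>f p. (f, p) \<in> N \<Longrightarrow> p = id"
    and quot: "\<And>f i j. (f, id) \<in> N \<Longrightarrow> i \<in> {1..r} \<Longrightarrow> j \<in> {1..r} \<Longrightarrow> f i \<otimes> inv f j \<in> axis G N"
    and r: "r \<ge> 1"
  shows "N = {(f, p). (f, p) \<in> carrier (W r) \<and> p = id \<and> (\<forall>i\<in>{1..r}. f i \<in> first_coords N) \<and>
                (\<forall>i\<in>{1..r}. \<forall>j\<in>{1..r}. f i \<otimes> inv f j \<in> axis G N)}" (is "N = ?R")
proof
  show "N \<subseteq> ?R"
  proof
    fix x assume x: "x \<in> N"
    obtain f p where fp: "x = (f, p)" by force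
    have "p = id" using base x fp by blast
    then show "x \<in> ?R"
      using x in_carrier[OF x] quot coord_in_first_coords by (auto simp: fp)
  qed
  show "?R \<subseteq> N"
  proof
    fix x assume "x \<in> ?R"
    then obtain f where x: "x = (f, id)" and c: "(f, id) \<in> carrier (W r)"
      and K: "\<And>i. i \<in> {1..r} \<Longrightarrow> f i \<in> first_coords N"
      and M: "\<And>i j. i \<in> {1..r} \<Longrightarrow> j \<in> {1..r} \<Longrightarrow> f i \<otimes> inv f j \<in> axis G N" by blast
    have fc: "f i \<in> carrier G" and f1: "i \<notin> {1..r} \<Longrightarrow> f i = \<one>" for i
      using c by (auto simp: wreath_sym_carrier_iff)
    have "f 1 \<in> first_coords N" using K r by simp
    then obtain h where h: "(h, id) \<in> N" "h 1 = f 1" by (auto simp: first_coords_def)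
    have hc: "h i \<in> carrier G" and h1: "i \<notin> {1..r} \<Longrightarrow> h i = \<one>" for i
      using in_carrier[OF h(1)] by (auto simp: wreath_sym_carrier_iff)
    interpret A: subgroup "axis G N" G
      using axis_normal[OF r] by (rule normal_imp_subgroup)
    have "(\<lambda>i. f i \<otimes> inv h i, id) \<in> N"
    proof (rule axis_power_subset)
      fix i assume i: "i \<in> {1..r}"
      have one: "1 \<in> {1..r}" using r by simp
      have "(f i \<otimes> inv f 1) \<otimes> (h 1 \<otimes> inv h i) \<in> axis G N"
        using M[OF i one] quot[OF h(1) one i] by (rule A.m_closed)
      moreover have "(f i \<otimes> inv f 1) \<otimes> (h 1 \<otimes> inv h i) = f i \<otimes> ((inv f 1 \<otimes> f 1) \<otimes> inv h i)"
        unfolding h(2) by (simp only: m_assoc m_closed inv_closed fc hc)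
      ultimately show "f i \<otimes> inv h i \<in> axis G N" using fc hc by simp
    qed (simp add: f1 h1)
    from base_mult[OF this h(1)] show "x \<in> N"
      using fc hc by (simp add: x m_assoc)
  qed
qed

end

context wreath_congruence
begin

text \<open>The class of the idempotent \<open>E {1..r}\<close>, seen inside its group \<open>\<H>\<close>-class.\<close>

definition units_class :: "nat \<Rightarrow> ((nat \<Rightarrow> 'a) \<times> (nat \<Rightarrow> nat)) set" where
  "units_class r = {x \<in> carrier (W r). (unit_embedding r x, E {1..r}) \<in> \<rho>}"

lemma units_class_normal:
  assumes r: "r \<le> n"
  shows "units_class r \<lhd> W r"
proof -
  interpret W: group "W r" by (rule wreath_sym_group)
  note car = unit_embedding_carrier[OF r] and mult = unit_embedding_mult[where n = n and r = r]
  have left_one: "E {1..r} \<otimes>\<^bsub>S n\<^esub> unit_embedding r x = unit_embedding r x" if "x \<in> carrier (W r)" for x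
    using mult[OF W.one_closed that] that by (simp add: unit_embedding_one)
  have right_one: "unit_embedding r x \<otimes>\<^bsub>S n\<^esub> E {1..r} = unit_embedding r x" if "x \<in> carrier (W r)" for x
    using mult[OF that W.one_closed] that by (simp add: unit_embedding_one)
  show ?thesis
    unfolding W.normal_inv_iff
  proof (intro conjI ballI)
    show "subgroup (units_class r) (W r)"
    proof (rule W.subgroupI)
      show "units_class r \<subseteq> carrier (W r)" by (auto simp: units_class_def)
      have "\<one>\<^bsub>W r\<^esub> \<in> units_class r"
        using related_refl[OF E_carrier[of "{1..r}"]] r by (simp add: units_class_def unit_embedding_one)
      then show "units_class r \<noteq> {}" by blast
      show "inv\<^bsub>W r\<^esub> a \<in> units_class r" if "a \<in> units_class r" for a
      proof -
        have a: "a \<in> carrier (W r)" "(unit_embedding r a, E {1..r}) \<in> \<rho>"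
          using that by (auto simp: units_class_def)
        have "(unit_embedding r a \<otimes>\<^bsub>S n\<^esub> unit_embedding r (inv\<^bsub>W r\<^esub> a),
            E {1..r} \<otimes>\<^bsub>S n\<^esub> unit_embedding r (inv\<^bsub>W r\<^esub> a)) \<in> \<rho>"
          using a by (intro related_mult_right car) auto
        then show ?thesis
          using a left_one[OF W.inv_closed[OF a(1)]]
          by (auto simp: unit_embedding_inv units_class_def intro: related_sym)
      qed
      show "a \<otimes>\<^bsub>W r\<^esub> b \<in> units_class r" if "a \<in> units_class r" "b \<in> units_class r" for a b
      proof -
        have a: "a \<in> carrier (W r)" "(unit_embedding r a, E {1..r}) \<in> \<rho>"
          and b: "b \<in> carrier (W r)" "(unit_embedding r b, E {1..r}) \<in> \<rho>"
          using that by (auto simp: units_class_def)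
        have "(unit_embedding r a \<otimes>\<^bsub>S n\<^esub> unit_embedding r b, E {1..r} \<otimes>\<^bsub>S n\<^esub> unit_embedding r b) \<in> \<rho>"
          using a b by (intro related_mult_right car) auto
        then have "(unit_embedding r (a \<otimes>\<^bsub>W r\<^esub> b), unit_embedding r b) \<in> \<rho>"
          using a b left_one[OF b(1)] by (simp add: mult)
        then show ?thesis
          using a b related_trans by (auto simp: units_class_def)
      qed
    qed
    show "x \<otimes>\<^bsub>W r\<^esub> h \<otimes>\<^bsub>W r\<^esub> inv\<^bsub>W r\<^esub> x \<in> units_class r" if x: "x \<in> carrier (W r)" and "h \<in> units_class r" for x h
    proof -
      have h: "h \<in> carrier (W r)" "(unit_embedding r h, E {1..r}) \<in> \<rho>"
        using that by (auto simp: units_class_def)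
      have "(unit_embedding r x \<otimes>\<^bsub>S n\<^esub> unit_embedding r h \<otimes>\<^bsub>S n\<^esub> unit_embedding r (inv\<^bsub>W r\<^esub> x),
          unit_embedding r x \<otimes>\<^bsub>S n\<^esub> E {1..r} \<otimes>\<^bsub>S n\<^esub> unit_embedding r (inv\<^bsub>W r\<^esub> x)) \<in> \<rho>"
        using x h by (intro related_mult_right related_mult_left car) auto
      then show ?thesis
        using x h right_one[OF x] by (simp add: units_class_def mult unit_embedding_inv)
    qed
  qed
qed

lemma units_class_wreath_normal: "r \<le> n \<Longrightarrow> wreath_normal G r (units_class r)"
  by (intro wreath_normalI units_class_normal)

text \<open>Restriction to the first \<open>r\<close> points is multiplication by an idempotent, so it maps the normal
  subgroup at one rank into the one at the rank below. All the coupling between ranks comes from this.\<close>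

lemma units_class_restrict:
  assumes r: "Suc r \<le> n" and f: "(f, id) \<in> units_class (Suc r)"
  shows "(\<lambda>i. if i \<in> {1..r} then f i else \<one>, id) \<in> units_class r"
proof -
  have fc: "f i \<in> carrier G" for i
    using f by (simp add: units_class_def wreath_sym_carrier_iff)
  have "(E {1..r} \<otimes>\<^bsub>S n\<^esub> unit_embedding (Suc r) (f, id), E {1..r} \<otimes>\<^bsub>S n\<^esub> E {1..Suc r}) \<in> \<rho>"
    using f r by (intro related_mult_left E_carrier) (auto simp: units_class_def)
  moreover have "E {1..r} \<otimes>\<^bsub>S n\<^esub> unit_embedding (Suc r) (f, id) =
      unit_embedding r (\<lambda>i. if i \<in> {1..r} then f i else \<one>, id)"
    using fc by (auto simp: unit_embedding_def partial_id_mult_monomial image_subset_iff monomial_eq_iff)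
  moreover have "E {1..r} \<otimes>\<^bsub>S n\<^esub> E {1..Suc r} = E {1..r}"
    by (simp add: Int_absorb2)
  ultimately show ?thesis
    using fc by (simp add: units_class_def base_carrier_iff)
qed

lemma first_coords_antimono:
  assumes "1 \<le> r" "Suc r \<le> n"
  shows "first_coords (units_class (Suc r)) \<subseteq> first_coords (units_class r)"
proof
  fix g assume "g \<in> first_coords (units_class (Suc r))"
  then obtain f where f: "(f, id) \<in> units_class (Suc r)" "g = f 1" by (auto simp: first_coords_def)
  show "g \<in> first_coords (units_class r)"
    unfolding first_coords_def f(2)
    by (intro CollectI exI[of _ "\<lambda>i. if i \<in> {1..r} then f i else \<one>"] conjI
        units_class_restrict[OF assms(2) f(1)]) (use assms in simp)
qed

lemma axis_antimono:
  assumes "1 \<le> r" "Suc r \<le> n"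
  shows "axis G (units_class (Suc r)) \<subseteq> axis G (units_class r)"
proof
  fix g assume g: "g \<in> axis G (units_class (Suc r))"
  have "(\<lambda>i. if i \<in> {1..r} then single G 1 g i else \<one>) = single G 1 g"
    using assms by (auto simp: single_def)
  then show "g \<in> axis G (units_class r)"
    using units_class_restrict[OF assms(2), of "single G 1 g"] g by (simp add: axis_def)
qed

text \<open>Two ranks above the collapsed part, restricting to all points but \<open>i\<close> still lands above
  the collapsed part, where images are preserved. So a permutation in the class fixes every
  complement of a point.\<close>

lemma units_class_base:
  assumes r: "r \<le> n" "level + 2 \<le> r" and x: "(f, p) \<in> units_class r"
  shows "p = id"
proof -
  have p: "p permutes {1..r}" and fc: "f i \<in> carrier G" and rel: "(monomial {1..r} f p, E {1..r}) \<in> \<rho>" for i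
    using x by (auto simp: units_class_def wreath_sym_carrier_iff unit_embedding_def)
  have "p i = i" for i
  proof (cases "i \<in> {1..r}")
    case True
    let ?B = "{1..r} - {i}"
    have "(E ?B \<otimes>\<^bsub>S n\<^esub> monomial {1..r} f p, E ?B \<otimes>\<^bsub>S n\<^esub> E {1..r}) \<in> \<rho>"
      using r by (intro related_mult_left[OF rel] E_carrier) auto
    moreover have "{1..r} \<inter> ?B = ?B" "?B \<inter> {1..r} = ?B" by auto
    ultimately have "(monomial ?B f p, E ?B) \<in> \<rho>"
      using fc by (simp add: partial_id_mult_monomial image_subset_iff)
    then have "(monomial ?B f p, monomial ?B (\<lambda>_. \<one>) id) \<in> \<rho>"
      by (simp only: partial_id_def)
    moreover have "level < card ?B" using True r by simp
    ultimately have "p ` ?B = id ` ?B" by (rule related_same_domain_image(2))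
    then have "p ` ?B = ?B" by simp
    moreover have "p ` {1..r} = {1..r}" using p by (rule permutes_image)
    ultimately have "p i \<in> {1..r}" "p i \<notin> ?B"
      using True permutes_inj[OF p] by (auto dest: injD)
    then show ?thesis by blast
  qed (use p in \<open>rule permutes_not_in\<close>)
  then show ?thesis by auto
qed

text \<open>A quotient of two entries gives an antipodal element. Moving its second entry to the last position
  and restricting cuts that entry off, so the quotient lies in the axis one rank below. If the axis
  does not change there, then the normal subgroup is determined by the two attached subgroups
  of \<open>G\<close>.\<close>

lemma units_class_determined:
  assumes r: "r \<le> n" "level + 2 \<le> r"
    and stable: "axis G (units_class r) = axis G (units_class (r - 1))"
  shows "units_class r =
           {(f, p). (f, p) \<in> carrier (W r) \<and> p = id \<and> (\<forall>i\<in>{1..r}. f i \<in> first_coords (units_class r)) \<and>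
                (\<forall>i\<in>{1..r}. \<forall>j\<in>{1..r}. f i \<otimes> inv f j \<in> axis G (units_class r))}"
proof -
  interpret U: wreath_normal G r "units_class r"
    using r by (intro units_class_wreath_normal)
  obtain q where q: "r = Suc q" using r by (cases r) auto
  show ?thesis
  proof (rule U.base_subgroup_eq)
    show "p = id" if "(f, p) \<in> units_class r" for f p
      using units_class_base[OF r that] .
    show "f i \<otimes> inv f j \<in> axis G (units_class r)"
      if f: "(f, id) \<in> units_class r" and i: "i \<in> {1..r}" and j: "j \<in> {1..r}" for f i j
    proof (cases "i = j")
      case True
      have "\<one> \<in> axis G (units_class r)"
        using r by (intro subgroup.one_closed normal_imp_subgroup U.axis_normal) simp
      then show ?thesis using True U.base_coord_closed[OF f] by simp
    next
      case False
      let ?d = "f i \<otimes> inv f j"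
      have "(antipodal G i j ?d, id) \<in> units_class r"
        by (rule U.base_coord_quotient[OF f i j False])
      then have "(antipodal G 1 r ?d, id) \<in> units_class r"
        by (rule U.antipodal_move) (use i j False r in auto)
      then have "(\<lambda>k. if k \<in> {1..q} then antipodal G 1 r ?d k else \<one>, id) \<in> units_class q"
        using units_class_restrict[of q] r q by simp
      moreover have "(\<lambda>k. if k \<in> {1..q} then antipodal G 1 r ?d k else \<one>) = single G 1 ?d"
        using r by (auto simp: antipodal_def single_def q)
      ultimately have "?d \<in> axis G (units_class (r - 1))"
        using U.base_coord_closed[OF f] by (simp add: axis_def q)
      then show ?thesis by (simp add: stable)
    qed
  qed (use r in simp)
qed

end

context group
begin

text \<open>For \<open>x\<close> and \<open>y\<close> with equal domain and image, multiplying by the inverse of \<open>y\<close> and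
  conjugating by a bijection onto \<open>{1..r}\<close> turns the pair \<open>(x, y)\<close> into a unit \<open>u\<close>. The
  construction is reversible and does not involve the congruence, hence the same \<open>u\<close> works
  for all of them.\<close>

lemma related_iff_unit:
  assumes x: "monomial A f p \<in> carrier (S n)" and y: "monomial A h s \<in> carrier (S n)" and im: "p ` A = s ` A"
  shows "\<exists>u. \<forall>\<rho>. wreath_congruence G n \<rho> \<longrightarrow>
           ((monomial A f p, monomial A h s) \<in> \<rho> \<longleftrightarrow> u \<in> wreath_congruence.units_class G \<rho> (card A))"
proof -
  define r where "r = card A"
  have A: "A \<subseteq> {1..n}" and p: "inj_on p A" "p ` A \<subseteq> {1..n}" and f: "\<And>i. i \<in> A \<Longrightarrow> f i \<in> carrier G"
    and s: "inj_on s A" and h: "\<And>i. i \<in> A \<Longrightarrow> h i \<in> carrier G"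
    using x y by (auto simp: monomial_carrier_iff)
  have rn: "r \<le> n" using card_mono[OF _ A] by (simp add: r_def)
  obtain \<alpha> where \<alpha>: "bij_betw \<alpha> {1..r} A"
    using ex_bij_betw_nat_finite_1[OF finite_subset[OF A]] by (auto simp: r_def)
  define \<beta> where "\<beta> = inv_into {1..r} \<alpha>"
  have \<beta>: "bij_betw \<beta> A {1..r}" unfolding \<beta>_def by (rule bij_betw_inv_into[OF \<alpha>])
  have \<alpha>\<beta>: "\<And>i. i \<in> A \<Longrightarrow> \<alpha> (\<beta> i) = i" and \<beta>\<alpha>: "\<And>i. i \<in> {1..r} \<Longrightarrow> \<beta> (\<alpha> i) = i"
    using \<alpha> by (auto simp: \<beta>_def bij_betw_inv_into_right bij_betw_inv_into_left)
  have \<alpha>A: "\<And>i. i \<in> {1..r} \<Longrightarrow> \<alpha> i \<in> A" and \<beta>r: "\<And>i. i \<in> A \<Longrightarrow> \<beta> i \<in> {1..r}"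
    using \<alpha> \<beta> by (auto dest: bij_betwE)
  define t where "t = (\<lambda>i. inv_into A s (p i))"
  have tA: "t i \<in> A" and st: "s (t i) = p i" if "i \<in> A" for i
  proof -
    have "p i \<in> s ` A" using im that by blast
    then show "t i \<in> A" "s (t i) = p i" unfolding t_def by (auto intro: inv_into_into f_inv_into_f)
  qed
  have t: "bij_betw t A A"
  proof -
    have "inj_on t A"
      using st p(1) by (intro inj_onI) (metis inj_onD)
    then show ?thesis
      using tA by (intro bij_betw_imageI endo_inj_surj[OF finite_subset[OF A]]) auto
  qed
  let ?g = "\<lambda>i. f i \<otimes> inv h (t i)"
  let ?x = "monomial A f p" and ?y = "monomial A h s" and ?y' = "partial_inverse G A h s"
  let ?v = "monomial A ?g t"
  let ?a = "monomial {1..r} (\<lambda>_. \<one>) \<alpha>" and ?a' = "monomial A (\<lambda>_. \<one>) \<beta>"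
  define u where "u = ((\<lambda>i. if i \<in> {1..r} then ?g (\<alpha> i) else \<one>), (\<lambda>i. if i \<in> {1..r} then \<beta> (t (\<alpha> i)) else i))"
  have "bij_betw (\<beta> \<circ> t \<circ> \<alpha>) {1..r} {1..r}"
    using \<alpha> t \<beta> by (intro bij_betw_trans)
  then have "bij_betw (\<lambda>i. if i \<in> {1..r} then \<beta> (t (\<alpha> i)) else i) {1..r} {1..r}"
    by (subst bij_betw_cong[where g = "\<beta> \<circ> t \<circ> \<alpha>"]) auto
  then have "(\<lambda>i. if i \<in> {1..r} then \<beta> (t (\<alpha> i)) else i) permutes {1..r}"
    by (rule bij_imp_permutes) auto
  then have u: "u \<in> carrier (W r)"
    using f h tA \<alpha>A by (auto simp: u_def wreath_sym_carrier_iff)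
  have emb: "unit_embedding r u = monomial {1..r} (\<lambda>i. ?g (\<alpha> i)) (\<lambda>i. \<beta> (t (\<alpha> i)))"
    by (simp add: unit_embedding_def u_def monomial_eq_iff)
  have car: "?y' \<in> carrier (S n)" "?a \<in> carrier (S n)" "?a' \<in> carrier (S n)" "E A \<in> carrier (S n)"
    using y \<alpha> \<beta> A rn \<alpha>A \<beta>r
    by (auto intro!: partial_inverse_carrier simp: monomial_carrier_iff partial_id_def bij_betw_def)
  have v: "?x \<otimes>\<^bsub>S n\<^esub> ?y' = ?v"
    using im by (auto simp: partial_inverse_def monomial_mult monomial_eq_iff t_def)
  have vy: "?v \<otimes>\<^bsub>S n\<^esub> ?y = ?x"
    using f h tA st by (auto simp: monomial_mult monomial_eq_iff m_assoc)
  have Ey: "E A \<otimes>\<^bsub>S n\<^esub> ?y = ?y"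
    using h by (auto simp: partial_id_mult_monomial image_subset_iff)
  have ava: "?a \<otimes>\<^bsub>S n\<^esub> ?v \<otimes>\<^bsub>S n\<^esub> ?a' = unit_embedding r u"
    unfolding emb using f h tA \<alpha>A by (auto simp: monomial_mult monomial_eq_iff)
  have aEa: "?a \<otimes>\<^bsub>S n\<^esub> E A \<otimes>\<^bsub>S n\<^esub> ?a' = E {1..r}"
    using \<alpha>A \<beta>\<alpha> by (auto simp: partial_id_def monomial_mult monomial_eq_iff)
  have aua: "?a' \<otimes>\<^bsub>S n\<^esub> unit_embedding r u \<otimes>\<^bsub>S n\<^esub> ?a = ?v"
    unfolding emb using f h tA \<alpha>A \<beta>r \<alpha>\<beta> by (auto simp: monomial_mult monomial_eq_iff)
  have aEa': "?a' \<otimes>\<^bsub>S n\<^esub> E {1..r} \<otimes>\<^bsub>S n\<^esub> ?a = E A"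
    using \<beta>r \<alpha>\<beta> by (auto simp: partial_id_def monomial_mult monomial_eq_iff)
  have "(?x, ?y) \<in> \<rho> \<longleftrightarrow> u \<in> wreath_congruence.units_class G \<rho> r" if "wreath_congruence G n \<rho>" for \<rho>
  proof -
    interpret wreath_congruence G n \<rho> by (rule that)
    show ?thesis
    proof
      assume "(?x, ?y) \<in> \<rho>"
      then have "(?x \<otimes>\<^bsub>S n\<^esub> ?y', ?y \<otimes>\<^bsub>S n\<^esub> ?y') \<in> \<rho>"
        using car by (intro related_mult_right)
      then have "(?v, E A) \<in> \<rho>"
        unfolding v mult_partial_inverse[OF y] .
      then have "(?a \<otimes>\<^bsub>S n\<^esub> ?v \<otimes>\<^bsub>S n\<^esub> ?a', ?a \<otimes>\<^bsub>S n\<^esub> E A \<otimes>\<^bsub>S n\<^esub> ?a') \<in> \<rho>"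
        using car by (intro related_mult_right related_mult_left)
      then show "u \<in> units_class r"
        unfolding ava aEa units_class_def using u by simp
    next
      assume "u \<in> units_class r"
      then have "(unit_embedding r u, E {1..r}) \<in> \<rho>" by (simp add: units_class_def)
      then have "(?a' \<otimes>\<^bsub>S n\<^esub> unit_embedding r u \<otimes>\<^bsub>S n\<^esub> ?a, ?a' \<otimes>\<^bsub>S n\<^esub> E {1..r} \<otimes>\<^bsub>S n\<^esub> ?a) \<in> \<rho>"
        using car by (intro related_mult_right related_mult_left)
      then have "(?v \<otimes>\<^bsub>S n\<^esub> ?y, E A \<otimes>\<^bsub>S n\<^esub> ?y) \<in> \<rho>"
        unfolding aua aEa' using y by (intro related_mult_right)
      then show "(?x, ?y) \<in> \<rho>" unfolding vy Ey .
    qed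
  qed
  then show ?thesis unfolding r_def by blast
qed

end

context wreath_congruence
begin

text \<open>The ranks at which the normal subgroup is not forced by the rank below: the first rank above
  the collapsed part, and those where one of the two attached subgroups of \<open>G\<close> shrinks.\<close>

definition jumps :: "nat set" where
  "jumps = {r. level < r \<and> r \<le> n \<and> (r = Suc level \<or>
     first_coords (units_class r) \<noteq> first_coords (units_class (r - 1)) \<or>
     axis G (units_class r) \<noteq> axis G (units_class (r - 1)))}"

definition jump_data :: "(nat \<times> ((nat \<Rightarrow> 'a) \<times> (nat \<Rightarrow> nat)) set) set" where
  "jump_data = (\<lambda>r. (r, units_class r)) ` jumps"

end

locale two_wreath_congruences =
  P: wreath_congruence G n \<rho> + Q: wreath_congruence G n \<sigma> for G (structure) and n \<rho> \<sigma>
begin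

lemma subset_of_units_class:
  assumes level: "P.level = Q.level" and units: "\<And>r. P.level < r \<Longrightarrow> r \<le> n \<Longrightarrow> P.units_class r = Q.units_class r"
  shows "\<rho> \<subseteq> \<sigma>"
proof
  fix xy assume "xy \<in> \<rho>"
  then obtain x y where xy: "xy = (x, y)" and rel: "(x, y) \<in> \<rho>" by (cases xy) auto
  note car = P.related_carrier[OF rel]
  obtain A f p B h s where x: "x = monomial A f p" and y: "y = monomial B h s"
    using car by (metis carrier_monomialE)
  show "xy \<in> \<sigma>"
  proof (cases "card A \<le> P.level")
    case True
    have "card B \<le> P.level"
      using P.related_same_domain_image(1)[OF P.related_sym[OF rel[unfolded x y]]] True by fastforce
    then have "(x, partial_id G {}) \<in> \<sigma>" "(y, partial_id G {}) \<in> \<sigma>"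
      using True car Q.collapse_iff_level level unfolding x y by auto
    then show ?thesis
      unfolding xy using Q.related_sym Q.related_trans by blast
  next
    case False
    then have B: "B = A" and im: "p ` A = s ` A"
      using P.related_same_domain_image[OF rel[unfolded x y]] by auto
    have "A \<subseteq> {1..n}" using car by (simp add: x monomial_carrier_iff)
    then have "card A \<le> n" using card_mono[of "{1..n}" A] by simp
    then have "P.units_class (card A) = Q.units_class (card A)"
      using units False by simp
    moreover obtain u where "\<And>\<tau>. wreath_congruence G n \<tau> \<Longrightarrow>
           ((x, y) \<in> \<tau> \<longleftrightarrow> u \<in> wreath_congruence.units_class G \<tau> (card A))"
      using P.related_iff_unit[OF car[unfolded x y B] im] unfolding x y B by blast
    ultimately show ?thesis
      using rel P.wreath_congruence_axioms Q.wreath_congruence_axioms unfolding xy by metis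
  qed
qed

lemma level_le_of_jumps:
  assumes "P.jumps = Q.jumps"
  shows "Q.level \<le> P.level"
proof (cases "P.level < n")
  case True
  then have "Suc P.level \<in> P.jumps" by (simp add: P.jumps_def)
  then have "Suc P.level \<in> Q.jumps" using assms by simp
  then show ?thesis by (simp add: Q.jumps_def)
next
  case False
  then show ?thesis using Q.level_le by simp
qed

interpretation swap: two_wreath_congruences G n \<sigma> \<rho>
  by unfold_locales

text \<open>The least jump reveals the level. From there the normal subgroups agree at the jumps by
  hypothesis and at the other ranks by induction.\<close>

lemma subset_of_jump_data:
  assumes eq: "P.jump_data = Q.jump_data"
  shows "\<rho> \<subseteq> \<sigma>"
proof -
  have jumps: "P.jumps = Q.jumps"
    using arg_cong[OF eq, of "image fst"] by (simp add: P.jump_data_def Q.jump_data_def image_image)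
  have at_jump: "P.units_class r = Q.units_class r" if "r \<in> P.jumps" for r
  proof -
    have "(r, P.units_class r) \<in> Q.jump_data"
      using that unfolding eq[symmetric] P.jump_data_def by blast
    then show ?thesis by (auto simp: Q.jump_data_def)
  qed
  have level: "P.level = Q.level"
    using level_le_of_jumps[OF jumps] swap.level_le_of_jumps[OF jumps[symmetric]] by simp
  have "P.units_class r = Q.units_class r" if "Suc P.level \<le> r" "r \<le> n" for r
    using that
  proof (induction r rule: dec_induct)
    case base
    then show ?case by (intro at_jump) (simp add: P.jumps_def)
  next
    case (step r)
    then have IH: "P.units_class r = Q.units_class r" by simp
    show ?case
    proof (cases "Suc r \<in> P.jumps")
      case True
      then show ?thesis by (rule at_jump)
    next
      case False
      then have nP: "first_coords (P.units_class (Suc r)) = first_coords (P.units_class r)"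
        "axis G (P.units_class (Suc r)) = axis G (P.units_class r)"
        using step by (auto simp: P.jumps_def)
      from False have "Suc r \<notin> Q.jumps" by (simp add: jumps)
      then have nQ: "first_coords (Q.units_class (Suc r)) = first_coords (Q.units_class r)"
        "axis G (Q.units_class (Suc r)) = axis G (Q.units_class r)"
        using step by (auto simp: Q.jumps_def level)
      have "P.level + 2 \<le> Suc r" "Q.level + 2 \<le> Suc r" using step level by auto
      then show ?thesis
        using P.units_class_determined[of "Suc r"] Q.units_class_determined[of "Suc r"] step.prems nP nQ IH
        by simp
    qed
  qed
  then show ?thesis
    using level by (intro subset_of_units_class) auto
qed

end

section \<open>Chains of normal subgroups\<close>

text \<open>A set with at most \<open>m\<close> elements can be listed by a word of length \<open>m\<close>, padded with
  \<open>None\<close>.\<close>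

lemma card_subsets_card_le:
  assumes "finite X"
  shows "card {Y. Y \<subseteq> X \<and> card Y \<le> m} \<le> (card X + 1) ^ m"
proof -
  let ?X = "insert None (Some ` X)"
  let ?L = "{xs. set xs \<subseteq> ?X \<and> length xs = m}"
  have "Y \<in> (\<lambda>xs. {x. Some x \<in> set xs}) ` ?L" if Y: "Y \<subseteq> X" "card Y \<le> m" for Y
  proof -
    obtain ys where ys: "set ys = Y" "length ys = card Y"
      using finite_distinct_list[of Y] finite_subset[OF Y(1) assms] distinct_card by metis
    let ?xs = "map Some ys @ replicate (m - card Y) None"
    have "Y = {x. Some x \<in> set ?xs}" using ys(1) by auto
    moreover have "?xs \<in> ?L" using ys Y by auto
    ultimately show ?thesis by blast
  qed
  then have "{Y. Y \<subseteq> X \<and> card Y \<le> m} \<subseteq> (\<lambda>xs. {x. Some x \<in> set xs}) ` ?L" by blast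
  moreover have fin: "finite ?L" using assms by (intro finite_lists_length_eq) simp
  ultimately have "card {Y. Y \<subseteq> X \<and> card Y \<le> m} \<le> card ?L"
    by (rule surj_card_le[rotated])
  also have "\<dots> = (card X + 1) ^ m"
    using assms by (subst card_lists_length_eq) (simp_all add: card_insert_if card_image)
  finally show ?thesis .
qed

context group
begin

text \<open>Among the finitely many chains of normal subgroups, one with the most members is maximal.\<close>

lemma ex_chief_series:
  assumes fin: "finite (carrier G)" and C: "subset.chain {N. N \<lhd> G} C"
  shows "\<exists>D. chief_series G D \<and> card C \<le> card D"
proof -
  let ?C = "{D. subset.chain {N. N \<lhd> G} D}"
  have finN: "finite {N. N \<lhd> G}"
    by (rule finite_subset[of _ "Pow (carrier G)"])
       (auto dest!: normal_imp_subgroup subgroup.subset simp: fin)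
  have finC: "finite ?C"
    by (rule finite_subset[of _ "Pow {N. N \<lhd> G}"]) (auto simp: subset_chain_def finN)
  have "Max (card ` ?C) \<in> card ` ?C" using finC C by (intro Max_in) auto
  then obtain D where D: "D \<in> ?C" "card D = Max (card ` ?C)" by (auto simp: image_iff)
  have max: "card D' \<le> card D" if "D' \<in> ?C" for D'
    unfolding D(2) using that finC by (intro Max_ge) auto
  have "\<not> D \<subset> D'" if "D' \<in> ?C" for D'
  proof
    assume *: "D \<subset> D'"
    have "finite D'" using that finN by (auto simp: subset_chain_def intro: finite_subset)
    then show False using psubset_card_mono[OF _ *] max[OF that] by simp
  qed
  then have "chief_series G D"
    using D(1) by (auto simp: chief_series_def subset.maxchain_def)
  then show ?thesis using max C by blast
qed

lemma finite_chief_series: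
  assumes "finite (carrier G)"
  shows "finite {C. chief_series G C}"
proof (rule finite_subset)
  show "{C. chief_series G C} \<subseteq> Pow (Pow (carrier G))"
    by (auto simp: chief_series_def subset.maxchain_def subset_chain_def
        dest!: normal_imp_subgroup subgroup.subset)
qed (use assms in simp)

lemma card_chain_le_chief_length:
  assumes fin: "finite (carrier G)" and C: "subset.chain {N. N \<lhd> G} C"
  shows "card C \<le> chief_length G"
proof -
  obtain D where D: "chief_series G D" "card C \<le> card D" using ex_chief_series[OF assms] by blast
  have "card D \<le> chief_length G"
    unfolding chief_length_def using D(1) finite_chief_series[OF fin] by (intro Max_ge) auto
  then show ?thesis using D(2) by simp
qed

lemma chief_length_attained:
  assumes fin: "finite (carrier G)"
  shows "\<exists>C. chief_series G C \<and> card C = chief_length G"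
proof -
  have "\<exists>C. chief_series G C"
    using ex_chief_series[OF fin, of "{}"] by (auto simp: subset_chain_def)
  then have "Max (card ` {C. chief_series G C}) \<in> card ` {C. chief_series G C}"
    using finite_chief_series[OF fin] by (intro Max_in) auto
  then show ?thesis by (auto simp: chief_length_def image_iff)
qed

lemma chief_length_pos:
  assumes "finite (carrier G)"
  shows "chief_length G \<ge> 1"
proof -
  have "carrier G \<lhd> G"
    by (simp add: normal_inv_iff subgroup_self)
  then show ?thesis
    using card_chain_le_chief_length[OF assms, of "{carrier G}"] by (simp add: subset_chain_def)
qed

text \<open>The values at the descents, together with the initial value, form a strictly decreasing chain
  of normal subgroups.\<close>

lemma card_descents_less_chief_length:
  assumes fin: "finite (carrier G)" and X: "\<And>r. a \<le> r \<Longrightarrow> r \<le> b \<Longrightarrow> X r \<lhd> G"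
    and anti: "\<And>r. a \<le> r \<Longrightarrow> r < b \<Longrightarrow> X (Suc r) \<subseteq> X r" and ab: "a \<le> b"
  shows "card {r. a < r \<and> r \<le> b \<and> X r \<noteq> X (r - 1)} < chief_length G"
proof -
  let ?J = "{r. a < r \<and> r \<le> b \<and> X r \<noteq> X (r - 1)}"
  have mono: "X s \<subseteq> X r" if "r \<le> s" "a \<le> r" "s \<le> b" for r s
    using that(1,3)
  proof (induction s rule: dec_induct)
    case (step s)
    then show ?case using anti[of s] that(2) by simp
  qed simp
  have strict: "X s \<noteq> X r" if "r < s" "a \<le> r" "s \<in> ?J" for r s
  proof -
    have "X s \<subseteq> X (s - 1)" by (rule mono) (use that in auto)
    moreover have "X (s - 1) \<subseteq> X r" by (rule mono) (use that in auto)
    moreover have "X s \<noteq> X (s - 1)" using that(3) by blast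
    ultimately show ?thesis by blast
  qed
  have ge: "a \<le> r" if "r \<in> insert a ?J" for r
    using that by (elim insertE) simp_all
  have "X s \<noteq> X r" if "r \<in> insert a ?J" "s \<in> insert a ?J" "r < s" for r s
  proof -
    have "s \<in> ?J" using that(2,3) ge[OF that(1)] by (elim insertE) simp_all
    then show ?thesis using strict that(3) ge[OF that(1)] by blast
  qed
  note differ = this
  have "inj_on X (insert a ?J)"
  proof (rule inj_onI)
    fix r s assume rs: "r \<in> insert a ?J" "s \<in> insert a ?J" "X r = X s"
    show "r = s"
    proof (rule linorder_cases[of r s])
      assume "r < s"
      from differ[OF rs(1,2) this] rs(3)[symmetric] show ?thesis by contradiction
    next
      assume "s < r"
      from differ[OF rs(2,1) this] rs(3) show ?thesis by contradiction
    qed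
  qed
  then have "card (X ` insert a ?J) = card (insert a ?J)" by (rule card_image)
  also have "\<dots> = Suc (card ?J)" by (subst card_insert_disjoint) auto
  finally have "Suc (card ?J) = card (X ` insert a ?J)" by simp
  also have "\<dots> \<le> chief_length G"
  proof (rule card_chain_le_chief_length[OF fin])
    have "X r \<subseteq> X s \<or> X s \<subseteq> X r" if "r \<in> {a..b}" "s \<in> {a..b}" for r s
      using mono[of r s] mono[of s r] that by (cases "r \<le> s") auto
    moreover have "insert a ?J \<subseteq> {a..b}" using ab by auto
    ultimately show "subset.chain {N. N \<lhd> G} (X ` insert a ?J)"
      unfolding subset_chain_def using X by (auto 0 4)
  qed
  finally show ?thesis by simp
qed

end

section \<open>The upper bound\<close>

context wreath_congruence
begin

text \<open>The first rank above the collapsed part contributes 1, and each of the two decreasing sequences of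
  normal subgroups of \<open>G\<close> contributes at most one less than the chief length.\<close>

lemma card_jumps_le:
  assumes fin: "finite (carrier G)"
  shows "card jumps \<le> 2 * chief_length G - 1"
proof (cases "Suc level \<le> n")
  case False
  then have "jumps = {}" by (auto simp: jumps_def)
  then show ?thesis by simp
next
  case True
  let ?J = "\<lambda>X. {r. Suc level < r \<and> r \<le> n \<and> X r \<noteq> X (r - 1)}"
  let ?K = "\<lambda>r. first_coords (units_class r)" and ?M = "\<lambda>r. axis G (units_class r)"
  have "card (?J ?K) < chief_length G"
    using True by (intro card_descents_less_chief_length[OF fin] first_coords_antimono
        wreath_normal.first_coords_normal[OF units_class_wreath_normal]) auto
  moreover have "card (?J ?M) < chief_length G"
    using True by (intro card_descents_less_chief_length[OF fin] axis_antimono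
        wreath_normal.axis_normal[OF units_class_wreath_normal]) auto
  moreover have "card jumps \<le> card ({Suc level} \<union> ?J ?K \<union> ?J ?M)"
    by (intro card_mono finite_UnI) (auto simp: jumps_def)
  moreover have "card ({Suc level} \<union> ?J ?K \<union> ?J ?M) \<le> card {Suc level} + card (?J ?K) + card (?J ?M)"
    by (intro order_trans[OF card_Un_le] add_mono) auto
  ultimately show ?thesis by simp
qed

end

context group
begin

text \<open>A congruence is encoded by its jumps together with the normal subgroups found there. The
  pairs of a rank and a normal subgroup at that rank are at most \<open>B n\<close> in number, and the code is a
  set of at most \<open>2 c - 1\<close> of them.\<close>

lemma card_congruences_upper:
  assumes fin: "finite (carrier G)"
  shows "\<exists>B>0. \<forall>n\<ge>1. card (congruences (S n)) \<le> B * n ^ (2 * chief_length G - 1)"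
proof -
  let ?m = "2 * chief_length G - 1"
  obtain B where B: "\<And>r. card {N. N \<lhd> W r} \<le> B"
    using card_wreath_normals_bounded[OF fin] by blast
  have "card (congruences (S n)) \<le> (B + 1) ^ ?m * n ^ ?m" if n: "n \<ge> 1" for n
  proof -
    let ?X = "SIGMA r:{1..n}. {N. N \<lhd> W r}"
    have finX: "finite ?X" using finite_wreath_normals[OF fin] by simp
    have "card ?X = (\<Sum>r\<in>{1..n}. card {N. N \<lhd> W r})"
      using finite_wreath_normals[OF fin] by (intro card_SigmaI) auto
    also have "\<dots> \<le> n * B" using sum_bounded_above[of "{1..n}" "\<lambda>r. card {N. N \<lhd> W r}" B] B by simp
    finally have cardX: "card ?X \<le> n * B" .
    have "card (congruences (S n)) \<le> card {Y. Y \<subseteq> ?X \<and> card Y \<le> ?m}"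
    proof (rule card_inj_on_le)
      have cong: "wreath_congruence G n \<rho>" if "\<rho> \<in> congruences (S n)" for \<rho>
        by (intro wreath_congruence.intro wreath_congruence_axioms.intro group_axioms that)
      show "inj_on (wreath_congruence.jump_data G n) (congruences (S n))"
      proof (rule inj_onI)
        fix \<rho> \<sigma> assume *: "\<rho> \<in> congruences (S n)" "\<sigma> \<in> congruences (S n)"
          "wreath_congruence.jump_data G n \<rho> = wreath_congruence.jump_data G n \<sigma>"
        then show "\<rho> = \<sigma>"
          using two_wreath_congruences.subset_of_jump_data[OF two_wreath_congruences.intro, of G n \<rho> \<sigma>]
            two_wreath_congruences.subset_of_jump_data[OF two_wreath_congruences.intro, of G n \<sigma> \<rho>] cong
          by (intro equalityI) auto
      qed
      show "wreath_congruence.jump_data G n ` congruences (S n) \<subseteq> {Y. Y \<subseteq> ?X \<and> card Y \<le> ?m}"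
      proof (intro image_subsetI CollectI conjI)
        fix \<rho> assume "\<rho> \<in> congruences (S n)"
        then interpret wreath_congruence G n \<rho> by (rule cong)
        show "jump_data \<subseteq> ?X"
          using units_class_normal by (auto simp: jump_data_def jumps_def)
        have "finite jumps" by (rule finite_subset[of _ "{..n}"]) (auto simp: jumps_def)
        then have "card jump_data \<le> card jumps" unfolding jump_data_def by (rule card_image_le)
        then show "card jump_data \<le> ?m" using card_jumps_le[OF fin] by simp
      qed
      show "finite {Y. Y \<subseteq> ?X \<and> card Y \<le> ?m}"
        by (rule finite_subset[of _ "Pow ?X"]) (use finX in auto)
    qed
    also have "\<dots> \<le> (card ?X + 1) ^ ?m" by (rule card_subsets_card_le[OF finX])
    also have "\<dots> \<le> ((B + 1) * n) ^ ?m"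
      using cardX n by (intro power_mono) (auto simp: algebra_simps)
    also have "\<dots> = (B + 1) ^ ?m * n ^ ?m" by (rule power_mult_distrib)
    finally show ?thesis .
  qed
  then show ?thesis by (intro exI[of _ "(B + 1) ^ ?m"]) auto
qed

end

section \<open>The lower bound\<close>

text \<open>A Rees congruence up to rank \<open>l\<close>, joined to the congruences that reduce the entries modulo a
  normal subgroup which may vary with the rank.\<close>

definition layered_congruence :: "('a, 'b) monoid_scheme \<Rightarrow> nat \<Rightarrow> nat \<Rightarrow> (nat \<Rightarrow> 'a set)
    \<Rightarrow> (((nat \<Rightarrow> 'a option) \<times> (nat \<rightharpoonup> nat)) \<times> ((nat \<Rightarrow> 'a option) \<times> (nat \<rightharpoonup> nat))) set" where
  "layered_congruence G n l K =
     {(monomial A f p, monomial B h s) | A f p B h s.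
        monomial A f p \<in> carrier (wreath_sym_inv G n) \<and> monomial B h s \<in> carrier (wreath_sym_inv G n) \<and>
        (card A \<le> l \<and> card B \<le> l \<or>
         A = B \<and> (\<forall>i\<in>A. p i = s i \<and> f i \<otimes>\<^bsub>G\<^esub> inv\<^bsub>G\<^esub> h i \<in> K (card A)))}"

lemma ex_chain_enumeration:
  assumes "finite C" "\<And>X Y. X \<in> C \<Longrightarrow> Y \<in> C \<Longrightarrow> X \<subseteq> Y \<or> Y \<subseteq> X" "\<And>X. X \<in> C \<Longrightarrow> finite X"
  shows "\<exists>L. (\<forall>i<card C. L i \<in> C) \<and> (\<forall>i j. i < j \<longrightarrow> j < card C \<longrightarrow> L i \<subset> L j)"
proof -
  have inj: "inj_on card C"
    using assms by (intro inj_onI) (metis card_subset_eq)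
  obtain e where e: "bij_betw e {..<card (card ` C)} (card ` C)" "strict_mono_on {..<card (card ` C)} e"
    using ex_bij_betw_strict_mono_card[of "card ` C"] assms(1) by blast
  have cc: "card (card ` C) = card C" using inj by (rule card_image)
  define L where "L = (\<lambda>i. inv_into C card (e i))"
  have L: "L i \<in> C" "card (L i) = e i" if "i < card C" for i
  proof -
    have "e i \<in> card ` C" using e(1) that cc by (auto dest: bij_betwE)
    then show "L i \<in> C" "card (L i) = e i" by (auto simp: L_def inv_into_into f_inv_into_f)
  qed
  have "L i \<subset> L j" if "i < j" "j < card C" for i j
  proof -
    have "e i < e j" using e(2) that cc by (auto simp: strict_mono_on_def)
    then have lt: "card (L i) < card (L j)" using L[of i] L[of j] that by simp
    have "L i \<subseteq> L j \<or> L j \<subseteq> L i" using assms(2) L(1) that by simp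
    moreover have "\<not> L j \<subseteq> L i" using card_mono[of "L i" "L j"] lt assms(3)[OF L(1)] that by auto
    ultimately show ?thesis by blast
  qed
  then show ?thesis using L(1) by blast
qed

context group
begin

lemma finite_wreath_sym_inv:
  assumes "finite (carrier G)"
  shows "finite (carrier (S n))"
proof (rule finite_subset)
  let ?X = "Pow {1..n} \<times> ({1..n} \<rightarrow>\<^sub>E carrier G) \<times> ({1..n} \<rightarrow>\<^sub>E {1..n})"
  show "carrier (S n) \<subseteq> (\<lambda>(A, f, p). monomial A f p) ` ?X"
  proof
    fix x assume x: "x \<in> carrier (S n)"
    then obtain A f p where Afp: "x = monomial A f p" by (rule carrier_monomialE)
    let ?f = "\<lambda>i\<in>{1..n}. if i \<in> A then f i else \<one>" and ?p = "\<lambda>i\<in>{1..n}. if i \<in> A then p i else i"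
    have eq: "monomial A f p = monomial A ?f ?p" and mem: "(A, ?f, ?p) \<in> ?X"
      using x by (auto simp: Afp monomial_carrier_iff monomial_eq_iff subset_iff image_subset_iff)
    show "x \<in> (\<lambda>(A, f, p). monomial A f p) ` ?X"
      unfolding Afp eq by (rule image_eqI[OF _ mem]) (simp only: prod.case)
  qed
  show "finite ((\<lambda>(A, f, p). monomial A f p) ` ?X)"
    using assms by (intro finite_imageI finite_cartesian_product finite_PiE) auto
qed

lemma finite_congruences:
  assumes "finite (carrier G)"
  shows "finite (congruences (S n))"
proof (rule finite_subset)
  show "congruences (S n) \<subseteq> Pow (carrier (S n) \<times> carrier (S n))"
    by (auto simp: congruences_def semigroup_congruence_def equiv_def refl_on_def)
qed (simp add: finite_wreath_sym_inv assms)

lemma layered_congruence_iff: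
  "(monomial A f p, monomial B h s) \<in> layered_congruence G n l K \<longleftrightarrow>
     monomial A f p \<in> carrier (S n) \<and> monomial B h s \<in> carrier (S n) \<and>
     (card A \<le> l \<and> card B \<le> l \<or>
      A = B \<and> (\<forall>i\<in>A. p i = s i \<and> f i \<otimes> inv h i \<in> K (card A)))"  (is "?L = ?R")
proof
  assume ?L
  then obtain A' f' p' B' h' s' where
      eq: "monomial A f p = monomial A' f' p'" "monomial B h s = monomial B' h' s'"
    and car: "monomial A' f' p' \<in> carrier (S n)" "monomial B' h' s' \<in> carrier (S n)"
    and rel: "card A' \<le> l \<and> card B' \<le> l \<or> A' = B' \<and> (\<forall>i\<in>A'. p' i = s' i \<and> f' i \<otimes> inv h' i \<in> K (card A'))"
    unfolding layered_congruence_def by blast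
  have "A = A'" "B = B'" and "\<And>i. i \<in> A \<Longrightarrow> f i = f' i \<and> p i = p' i" "\<And>i. i \<in> B \<Longrightarrow> h i = h' i \<and> s i = s' i"
    using eq by (auto simp: monomial_eq_iff)
  then show ?R using car rel unfolding eq by auto
next
  assume ?R
  then show ?L unfolding layered_congruence_def by blast
qed

text \<open>Products cannot increase the rank, and \<open>K\<close> grows as the rank drops; normality of \<open>K r\<close>
  is what left multiplication needs.\<close>

lemma layered_congruence_congruence:
  assumes K: "\<And>r. K r \<lhd> G" and anti: "\<And>r r'. r \<le> r' \<Longrightarrow> K r' \<subseteq> K r"
  shows "layered_congruence G n l K \<in> congruences (S n)"
proof -
  let ?R = "layered_congruence G n l K"
  interpret K: normal "K r" G for r by (rule K)
  have mon: "\<exists>A f p. x = monomial A f p" if "x \<in> carrier (S n)" for x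
    using that by (metis carrier_monomialE)
  have sub: "?R \<subseteq> carrier (S n) \<times> carrier (S n)"
    by (auto simp: layered_congruence_def)
  have "equiv (carrier (S n)) ?R"
  proof (rule equivI)
    show "?R \<subseteq> carrier (S n) \<times> carrier (S n)" by (rule sub)
    show "refl_on (carrier (S n)) ?R"
    proof (rule refl_onI)
      fix x assume x: "x \<in> carrier (S n)"
      then obtain A f p where "x = monomial A f p" using mon by blast
      then show "(x, x) \<in> ?R"
        using x K.one_closed by (auto simp: layered_congruence_iff monomial_carrier_iff subset_iff image_subset_iff)
    qed
    show "sym ?R"
    proof (rule symI)
      fix x y assume xy: "(x, y) \<in> ?R"
      then obtain A f p B h s where e: "x = monomial A f p" "y = monomial B h s"
        using mon sub by (metis (no_types, lifting) SigmaE2 SigmaD1 subsetD)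
      have car: "x \<in> carrier (S n)" "y \<in> carrier (S n)" using xy sub by auto
      have "h i \<otimes> inv f i \<in> K r" if "f i \<otimes> inv h i \<in> K r" "f i \<in> carrier G" "h i \<in> carrier G" for i r
        using K.m_inv_closed[OF that(1)] that(2,3) by (simp add: inv_mult_group)
      then show "(y, x) \<in> ?R"
        using xy car unfolding e by (auto simp: layered_congruence_iff monomial_carrier_iff image_subset_iff)
    qed
    show "trans ?R"
    proof (rule transI)
      fix x y z assume xy: "(x, y) \<in> ?R" and yz: "(y, z) \<in> ?R"
      then obtain A f p B h s C k t where e: "x = monomial A f p" "y = monomial B h s" "z = monomial C k t"
        using mon sub by (metis (no_types, lifting) SigmaE2 subsetD)
      have car: "x \<in> carrier (S n)" "y \<in> carrier (S n)" "z \<in> carrier (S n)" using xy yz sub by auto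
      have "f i \<otimes> inv k i \<in> K r" if "f i \<otimes> inv h i \<in> K r" "h i \<otimes> inv k i \<in> K r"
        "f i \<in> carrier G" "h i \<in> carrier G" "k i \<in> carrier G" for i r
      proof -
        have "(f i \<otimes> inv h i) \<otimes> (h i \<otimes> inv k i) = f i \<otimes> ((inv h i \<otimes> h i) \<otimes> inv k i)"
          using that(3-5) by (simp only: m_assoc m_closed inv_closed)
        then show ?thesis using K.m_closed[OF that(1,2)] that(3-5) by simp
      qed
      then show "(x, z) \<in> ?R"
        using xy yz car unfolding e by (auto simp: layered_congruence_iff monomial_carrier_iff image_subset_iff)
    qed
  qed
  moreover have "(x \<otimes>\<^bsub>S n\<^esub> z, y \<otimes>\<^bsub>S n\<^esub> z) \<in> ?R \<and> (z \<otimes>\<^bsub>S n\<^esub> x, z \<otimes>\<^bsub>S n\<^esub> y) \<in> ?R"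
    if xy: "(x, y) \<in> ?R" and z: "z \<in> carrier (S n)" for x y z
  proof -
    obtain A f p B h s C k t where e: "x = monomial A f p" "y = monomial B h s" "z = monomial C k t"
      using mon sub xy z by (metis (no_types, lifting) SigmaE2 subsetD)
    have car: "x \<in> carrier (S n)" "y \<in> carrier (S n)" using xy sub by auto
    note closed = wreath_sym_inv_closed[OF car(1) z] wreath_sym_inv_closed[OF car(2) z]
      wreath_sym_inv_closed[OF z car(1)] wreath_sym_inv_closed[OF z car(2)]
    have fin: "finite A" "finite B" and f: "\<And>i. i \<in> A \<Longrightarrow> f i \<in> carrier G" and h: "\<And>i. i \<in> B \<Longrightarrow> h i \<in> carrier G"
      and k: "\<And>i. i \<in> C \<Longrightarrow> k i \<in> carrier G" and t: "inj_on t C"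
      using car z unfolding e by (auto simp: monomial_carrier_iff intro: finite_subset)
    have right: "card {i \<in> D. q i \<in> C} \<le> card D" if "finite D" for D and q :: "nat \<Rightarrow> nat"
      using that by (intro card_mono) auto
    have left: "card {i \<in> C. t i \<in> D} \<le> card D" if "finite D" for D
      using t that by (intro card_inj_on_le[of t]) (auto simp: inj_on_def)
    from xy consider "card A \<le> l" "card B \<le> l"
      | "A = B" "\<And>i. i \<in> A \<Longrightarrow> p i = s i \<and> f i \<otimes> inv h i \<in> K (card A)"
      unfolding e layered_congruence_iff by blast
    then show ?thesis
    proof cases
      case 1
      then show ?thesis
        using closed right[OF fin(1), of p] right[OF fin(2), of s] left[OF fin(1)] left[OF fin(2)]
        unfolding e monomial_mult layered_congruence_iff by auto
    next
      case 2
      have "f i \<otimes> k (p i) \<otimes> inv (h i \<otimes> k (s i)) \<in> K (card {i \<in> A. p i \<in> C})" if "i \<in> A" "p i \<in> C" for i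
      proof -
        have c: "f i \<in> carrier G" "h i \<in> carrier G" "k (p i) \<in> carrier G" "s i = p i"
          using that f h k 2 by auto
        have "f i \<otimes> k (p i) \<otimes> inv (h i \<otimes> k (s i)) = f i \<otimes> ((k (p i) \<otimes> inv k (p i)) \<otimes> inv h i)"
          unfolding c(4) using c(1-3) by (simp only: m_assoc m_closed inv_closed inv_mult_group)
        also have "\<dots> = f i \<otimes> inv h i" using c by simp
        finally show ?thesis using 2(2)[OF that(1)] anti[OF right[OF fin(1), of p]] by auto
      qed
      moreover have "k i \<otimes> f (t i) \<otimes> inv (k i \<otimes> h (t i)) \<in> K (card {i \<in> C. t i \<in> A})" if "i \<in> C" "t i \<in> A" for i
      proof -
        have c: "f (t i) \<in> carrier G" "h (t i) \<in> carrier G" "k i \<in> carrier G"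
          using that f h k 2 by auto
        have "k i \<otimes> f (t i) \<otimes> inv (k i \<otimes> h (t i)) = k i \<otimes> (f (t i) \<otimes> inv h (t i)) \<otimes> inv k i"
          using c by (simp add: m_assoc inv_mult_group)
        then show ?thesis
          using K.inv_op_closed2[OF c(3)] 2(2)[OF that(2)] anti[OF left[OF fin(1)]] by auto
      qed
      ultimately show ?thesis
        using closed 2 unfolding e monomial_mult layered_congruence_iff by auto
    qed
  qed
  ultimately show ?thesis
    by (auto simp: congruences_def semigroup_congruence_def)
qed

lemma layered_congruence_level:
  assumes "1 \<le> r" "r \<le> n"
  shows "(E {1..r}, E {}) \<in> layered_congruence G n l K \<longleftrightarrow> r \<le> l"
  using assms unfolding partial_id_def layered_congruence_iff
  by (auto simp: monomial_carrier_iff)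

lemma layered_congruence_layer:
  assumes "1 \<le> r" "r \<le> n" "l < r" "K r \<lhd> G" "g \<in> carrier G"
  shows "(monomial {1..r} (single G 1 g) id, E {1..r}) \<in> layered_congruence G n l K \<longleftrightarrow> g \<in> K r"
  using assms normal_imp_subgroup[OF assms(4), THEN subgroup.one_closed]
  unfolding partial_id_def layered_congruence_iff
  by (auto simp: monomial_carrier_iff single_def)

text \<open>A \<open>c\<close>-element subset \<open>T\<close> of \<open>{1..n}\<close> lists the ranks at which a layered congruence
  passes from one layer to the next. The number of members of \<open>T\<close> that are at least \<open>r\<close>
  is the height of rank \<open>r\<close>: height \<open>c\<close> means collapsed, and a smaller height \<open>j\<close> selects
  the \<open>j\<close>-th term of a chief series, counted from 0.\<close>

lemma binomial_le_card_congruences: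
  assumes fin: "finite (carrier G)"
  shows "n choose chief_length G \<le> card (congruences (S n))"
proof -
  define c where "c = chief_length G"
  have c: "c \<ge> 1" unfolding c_def by (rule chief_length_pos[OF fin])
  obtain C where C: "chief_series G C" "card C = c"
    unfolding c_def using chief_length_attained[OF fin] by blast
  have CN: "N \<lhd> G" "N \<subseteq> carrier G" if "N \<in> C" for N
    using C(1) that normal_imp_subgroup[THEN subgroup.subset]
    by (auto simp: chief_series_def subset.maxchain_def subset_chain_def)
  have "finite C" using C(2) c by (intro card_ge_0_finite) simp
  moreover have "finite N" if "N \<in> C" for N
    using CN(2)[OF that] fin by (rule finite_subset)
  moreover have "X \<subseteq> Y \<or> Y \<subseteq> X" if "X \<in> C" "Y \<in> C" for X Y
    using C(1) that by (auto simp: chief_series_def subset.maxchain_def subset_chain_def)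
  ultimately obtain L where LC: "\<And>i. i < c \<Longrightarrow> L i \<in> C" and L: "\<And>i j. i < j \<Longrightarrow> j < c \<Longrightarrow> L i \<subset> L j"
    using ex_chain_enumeration[of C] C(2) by auto
  have Lmono: "L i \<subseteq> L j" if "i \<le> j" "j < c" for i j
    using L[of i j] that by (cases "i = j") auto
  have Linj: "i = j" if "L i = L j" "i < c" "j < c" for i j
    using L[of i j] L[of j i] that by (cases i j rule: linorder_cases) auto
  define height where "height = (\<lambda>(T :: nat set) r. card {t \<in> T. r \<le> t})"
  \<comment> \<open>The cap at \<open>c - 1\<close> matters only for collapsed ranks, where it keeps \<open>K\<close> antitone and its values normal subgroups.\<close>
  define K where "K = (\<lambda>T r. L (min (height T r) (c - 1)))"
  let ?cong = "\<lambda>T. layered_congruence G n (Min T) (K T)"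
  let ?T = "{T. T \<subseteq> {1..n} \<and> card T = c}"
  have finT: "finite T" "T \<noteq> {}" if "T \<in> ?T" for T
    using that c by (auto intro: finite_subset)
  have height_low: "height T r = c" if "T \<in> ?T" "r \<le> Min T" for T r
  proof -
    have "{t \<in> T. r \<le> t} = T" using that finT[OF that(1)] by auto
    then show ?thesis using that by (simp add: height_def)
  qed
  have height_high: "height T r < c" if "T \<in> ?T" "Min T < r" for T r
  proof -
    have "Min T \<in> T" using finT[OF that(1)] by simp
    moreover have "Min T \<notin> {t \<in> T. r \<le> t}" using that(2) by (simp add: not_le)
    ultimately have "{t \<in> T. r \<le> t} \<subset> T" by blast
    from psubset_card_mono[OF finT(1)[OF that(1)] this] show ?thesis
      using that(1) by (simp add: height_def)
  qed
  have Kn: "K T r \<lhd> G" for T r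
    unfolding K_def using c by (intro CN(1) LC) simp
  have Kanti: "K T r' \<subseteq> K T r" if "T \<in> ?T" "r \<le> r'" for T r r'
  proof -
    have "height T r' \<le> height T r"
      unfolding height_def using finT(1)[OF that(1)] that(2) by (intro card_mono) auto
    then show ?thesis unfolding K_def using c by (intro Lmono) auto
  qed
  have inj: "inj_on ?cong ?T"
  proof (rule inj_onI)
    fix T U assume T: "T \<in> ?T" and U: "U \<in> ?T" and eq: "?cong T = ?cong U"
    have Min_bounds: "1 \<le> Min X" "Min X \<le> n" if "X \<in> ?T" for X
    proof -
      have "Min X \<in> {1..n}" using finT[OF that] Min_in[of X] that by blast
      then show "1 \<le> Min X" "Min X \<le> n" by auto
    qed
    have "Min T \<le> Min U"
      using layered_congruence_level[OF Min_bounds[OF T], of "Min T" "K T"]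
        layered_congruence_level[OF Min_bounds[OF T], of "Min U" "K U"] eq by simp
    moreover have "Min U \<le> Min T"
      using layered_congruence_level[OF Min_bounds[OF U], of "Min T" "K T"]
        layered_congruence_level[OF Min_bounds[OF U], of "Min U" "K U"] eq by simp
    ultimately have Min_eq: "Min T = Min U" by simp
    have height: "height T r = height U r" if r: "1 \<le> r" for r
    proof -
      consider "r \<le> Min T" | "Min T < r" "r \<le> n" | "n < r" by linarith
      then show ?thesis
      proof cases
        case 1
        then show ?thesis using height_low[OF T] height_low[OF U] Min_eq by simp
      next
        case 2
        have "g \<in> K T r \<longleftrightarrow> g \<in> K U r" if "g \<in> carrier G" for g
          using layered_congruence_layer[OF r 2(2) 2(1), of "K T" g]
            layered_congruence_layer[OF r 2(2), of "Min U" "K U" g] 2(1) Min_eq eq Kn that by simp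
        moreover have "K X r \<subseteq> carrier G" for X
          using Kn normal_imp_subgroup[THEN subgroup.subset] by blast
        ultimately have "K T r = K U r" by blast
        moreover have "height T r < c" "height U r < c"
          using height_high[OF T] height_high[OF U] 2(1) Min_eq by auto
        ultimately show ?thesis
          unfolding K_def by (intro Linj) (auto simp: min_def split: if_splits)
      next
        case 3
        then have "{t \<in> T. r \<le> t} = {}" "{t \<in> U. r \<le> t} = {}" using T U by auto
        then show ?thesis unfolding height_def by (simp only:)
      qed
    qed
    have step: "t \<in> X \<longleftrightarrow> height X t \<noteq> height X (Suc t)" if "X \<in> ?T" for X t
    proof (cases "t \<in> X")
      case True
      then have "{u \<in> X. t \<le> u} = insert t {u \<in> X. Suc t \<le> u}" by auto
      then show ?thesis using True finT(1)[OF that] by (simp add: height_def)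
    next
      case False
      then have "{u \<in> X. t \<le> u} = {u \<in> X. Suc t \<le> u}" by (auto simp: Suc_le_eq order_le_less)
      then show ?thesis using False by (simp add: height_def)
    qed
    show "T = U"
    proof (rule Set.set_eqI)
      fix t
      show "t \<in> T \<longleftrightarrow> t \<in> U"
      proof (cases "1 \<le> t")
        case True
        then show ?thesis using step[OF T, of t] step[OF U, of t] height[of t] height[of "Suc t"] by simp
      next
        case False
        then show ?thesis using T U by auto
      qed
    qed
  qed
  have "n choose c = card ?T"
    using n_subsets[of "{1..n}" c] by simp
  also have "\<dots> \<le> card (congruences (S n))"
  proof (rule card_inj_on_le[OF inj])
    show "?cong ` ?T \<subseteq> congruences (S n)"
      using Kn Kanti by (intro image_subsetI layered_congruence_congruence)
  qed (rule finite_congruences[OF fin])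
  finally show ?thesis by (simp add: c_def)
qed

text \<open>For \<open>n\<close> below the chief length \<open>c\<close> the left-hand side is at most 1.\<close>

lemma card_congruences_lower:
  assumes fin: "finite (carrier G)"
  shows "(1 / real (chief_length G) ^ chief_length G) * real n ^ chief_length G \<le> real (card (congruences (S n)))"
proof -
  let ?c = "chief_length G"
  have c: "?c \<ge> 1" by (rule chief_length_pos[OF fin])
  have eq: "(1 / real ?c ^ ?c) * real n ^ ?c = (real n / real ?c) ^ ?c" by (simp add: power_divide)
  show ?thesis
  proof (cases "?c \<le> n")
    case True
    then have "(real n / real ?c) ^ ?c \<le> real (n choose ?c)"
      by (rule binomial_ge_n_over_k_pow_k)
    also have "\<dots> \<le> real (card (congruences (S n)))"
      using binomial_le_card_congruences[OF fin] by simp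
    finally show ?thesis unfolding eq .
  next
    case False
    have "layered_congruence G n n (\<lambda>_. carrier G) \<in> congruences (S n)"
      by (intro layered_congruence_congruence) (auto simp: normal_inv_iff subgroup_self)
    then have "1 \<le> card (congruences (S n))"
      using finite_congruences[OF fin, of n] by (metis One_nat_def Suc_leI card_gt_0_iff empty_iff)
    moreover have "(real n / real ?c) ^ ?c \<le> 1"
      using False c by (intro power_le_one) auto
    ultimately show ?thesis unfolding eq by simp
  qed
qed

end

theorem theorem5p8:
  fixes G :: "('a, 'b) monoid_scheme" and c :: nat
  assumes "group G" and "finite (carrier G)" and "chief_length G = c"
  shows "\<exists>(A :: real) (B :: nat). A > 0 \<and> B > 0 \<and>
    (\<forall>n :: nat. n \<ge> 1 \<longrightarrow>
       A * real n ^ c \<le> real (card (congruences (wreath_sym_inv G n))) \<and>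
       card (congruences (wreath_sym_inv G n)) \<le> B * n ^ (2 * c - 1))"
proof -
  interpret group G by (rule assms(1))
  obtain B where B: "B > 0" "\<And>n. n \<ge> 1 \<Longrightarrow> card (congruences (wreath_sym_inv G n)) \<le> B * n ^ (2 * c - 1)"
    using card_congruences_upper[OF assms(2)] assms(3) by blast
  have "c \<ge> 1" using chief_length_pos[OF assms(2)] assms(3) by simp
  then have "1 / real c ^ c > 0" by simp
  then show ?thesis
    using B card_congruences_lower[OF assms(2)] unfolding assms(3) by blast
qed

end
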